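(* Let $G$ be a group and $B$ a subgroup of $G$. (i) There exists a universal quadratic map relative $B$, $q=q_{G,B}\colon G\to Q(G,B)$, to some group $Q(G,B)$; i.e. $q$ is quadratic relative $B$, and for any map of groups $f\colon G\to H$ which is quadratic relative $B$ there exists a unique homomorphism $\hat f\colon Q(G,B)\to H$ such that $\hat f q=f$. (ii) The sequence of group homomorphisms $$0\to G/BG'\otimes G/BG'\xrightarrow{\;w_q\;}Q(G,B)\xrightarrow{\;\widehat{\mathrm{id}}\;}G\to 1$$ is exact. Actually, it is a central group extension represented by the bilinear 2-cocycle $D\colon G\times G\to G/BG'\otimes G/BG'$, $D(a,b)=-\bar a\otimes\bar b$, which corresponds to the canonical section $q$ of $\widehat{\mathrm{id}}$.
   Context: For a function $f\colon G\to H$ between arbitrary groups, with the target written additively (though not necessarily abelian), put $d_f(a,b)=f(ab)-f(b)-f(a)$. The map $f$ is quadratic if $d_f$ is bilinear (a homomorphism in each variable) and $d_f(a,b)$ commutes with $f(c)$ for all $a,b,c\in G$. For a subgroup $B\le G$, $f$ is quadratic relative $B$ if $f$ is quadratic and $d_f(B\times G)=d_f(G\times B)=0$; in that case $w_f\colon G/BG'\otimes G/BG'\to H$ denotes the homomorphism with $w_f(\bar a\otimes\bar b)=d_f(a,b)$, where $G'=[G,G]$ and $\bar a$ is the class of $a$ in $G/BG'$. Homomorphisms are quadratic relative any subgroup; $\widehat{\mathrm{id}}$ denotes the homomorphism induced, via the universal property in (i), by the identity map of $G$. The 2-cocycle $D$ corresponding to the section $q$ is determined by $q(a)+q(b)=w_q(D(a,b))+q(ab)$.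 *)

theory Defs
  imports "HOL-Algebra.Algebra"
begin

text \<open>
  All groups are written multiplicatively, so the additive notation of the target group of a
  quadratic map is translated literally, keeping the order of the factors.
\<close>

section \<open>Quadratic maps\<close>

definition dev :: "'a monoid \<Rightarrow> 'h monoid \<Rightarrow> ('a \<Rightarrow> 'h) \<Rightarrow> 'a \<Rightarrow> 'a \<Rightarrow> 'h" where
  "dev G H f a b = f (a \<otimes>\<^bsub>G\<^esub> b) \<otimes>\<^bsub>H\<^esub> inv\<^bsub>H\<^esub> (f b) \<otimes>\<^bsub>H\<^esub> inv\<^bsub>H\<^esub> (f a)"

definition bilinear_map :: "'a monoid \<Rightarrow> 'h monoid \<Rightarrow> ('a \<Rightarrow> 'a \<Rightarrow> 'h) \<Rightarrow> bool" where
  "bilinear_map G H d \<longleftrightarrow>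
     (\<forall>c \<in> carrier G. (\<lambda>a. d a c) \<in> hom G H) \<and> (\<forall>c \<in> carrier G. (\<lambda>a. d c a) \<in> hom G H)"

definition quadratic :: "'a monoid \<Rightarrow> 'h monoid \<Rightarrow> ('a \<Rightarrow> 'h) \<Rightarrow> bool" where
  "quadratic G H f \<longleftrightarrow>
     f \<in> carrier G \<rightarrow> carrier H \<and>
     bilinear_map G H (dev G H f) \<and>
     (\<forall>a \<in> carrier G. \<forall>b \<in> carrier G. \<forall>c \<in> carrier G.
        dev G H f a b \<otimes>\<^bsub>H\<^esub> f c = f c \<otimes>\<^bsub>H\<^esub> dev G H f a b)"

definition quadratic_rel :: "'a monoid \<Rightarrow> 'a set \<Rightarrow> 'h monoid \<Rightarrow> ('a \<Rightarrow> 'h) \<Rightarrow> bool" where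
  "quadratic_rel G B H f \<longleftrightarrow>
     quadratic G H f \<and>
     (\<forall>b \<in> B. \<forall>a \<in> carrier G. dev G H f b a = \<one>\<^bsub>H\<^esub> \<and> dev G H f a b = \<one>\<^bsub>H\<^esub>)"

section \<open>Tensor products of abelian groups\<close>

definition tensor_relators ::
    "'a monoid \<Rightarrow> 'b monoid \<Rightarrow> ('a \<times> 'b \<Rightarrow>\<^sub>0 int) set" where
  "tensor_relators M N =
     {frag_of (x \<otimes>\<^bsub>M\<^esub> x', y) - frag_of (x, y) - frag_of (x', y) | x x' y.
        x \<in> carrier M \<and> x' \<in> carrier M \<and> y \<in> carrier N} \<union>
     {frag_of (x, y \<otimes>\<^bsub>N\<^esub> y') - frag_of (x, y) - frag_of (x, y') | x y y'.
        x \<in> carrier M \<and> y \<in> carrier N \<and> y' \<in> carrier N}"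

definition tensor_kernel ::
    "'a monoid \<Rightarrow> 'b monoid \<Rightarrow> ('a \<times> 'b \<Rightarrow>\<^sub>0 int) set" where
  "tensor_kernel M N =
     generate (free_Abelian_group (carrier M \<times> carrier N)) (tensor_relators M N)"

definition tensor :: "'a monoid \<Rightarrow> 'b monoid \<Rightarrow> ('a \<times> 'b \<Rightarrow>\<^sub>0 int) set monoid" where
  "tensor M N = free_Abelian_group (carrier M \<times> carrier N) Mod tensor_kernel M N"

definition tens :: "'a monoid \<Rightarrow> 'b monoid \<Rightarrow> 'a \<Rightarrow> 'b \<Rightarrow> ('a \<times> 'b \<Rightarrow>\<^sub>0 int) set" where
  "tens M N x y =
     tensor_kernel M N #>\<^bsub>free_Abelian_group (carrier M \<times> carrier N)\<^esub> frag_of (x, y)"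

section \<open>The group \<open>G/BG' \<otimes> G/BG'\<close> and the homomorphism \<open>w\<^sub>f\<close>\<close>

definition BG' :: "'a monoid \<Rightarrow> 'a set \<Rightarrow> 'a set" where
  "BG' G B = B <#>\<^bsub>G\<^esub> derived G (carrier G)"

definition bar :: "'a monoid \<Rightarrow> 'a set \<Rightarrow> 'a \<Rightarrow> 'a set" where
  "bar G B a = BG' G B #>\<^bsub>G\<^esub> a"

definition T_grp :: "'a monoid \<Rightarrow> 'a set \<Rightarrow> ('a set \<times> 'a set \<Rightarrow>\<^sub>0 int) set monoid" where
  "T_grp G B = tensor (G Mod BG' G B) (G Mod BG' G B)"

definition bar_tens :: "'a monoid \<Rightarrow> 'a set \<Rightarrow> 'a \<Rightarrow> 'a \<Rightarrow> ('a set \<times> 'a set \<Rightarrow>\<^sub>0 int) set" where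
  "bar_tens G B a b = tens (G Mod BG' G B) (G Mod BG' G B) (bar G B a) (bar G B b)"

text \<open>
  Homomorphisms characterised by a unique existence property are normalised to be
  \<^const>\<open>undefined\<close> outside the carrier of their domain.
\<close>

definition is_w :: "'a monoid \<Rightarrow> 'a set \<Rightarrow> 'h monoid \<Rightarrow> ('a \<Rightarrow> 'h) \<Rightarrow>
    (('a set \<times> 'a set \<Rightarrow>\<^sub>0 int) set \<Rightarrow> 'h) \<Rightarrow> bool" where
  "is_w G B H f w \<longleftrightarrow>
     w \<in> hom (T_grp G B) H \<and> w \<in> extensional (carrier (T_grp G B)) \<and>
     (\<forall>a \<in> carrier G. \<forall>b \<in> carrier G. w (bar_tens G B a b) = dev G H f a b)"

definition w_map :: "'a monoid \<Rightarrow> 'a set \<Rightarrow> 'h monoid \<Rightarrow> ('a \<Rightarrow> 'h) \<Rightarrow>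
    ('a set \<times> 'a set \<Rightarrow>\<^sub>0 int) set \<Rightarrow> 'h" where
  "w_map G B H f = (THE w. is_w G B H f w)"

section \<open>Groups given by generators and relations\<close>

text \<open>
  In a word over \<open>S\<close>, the letter \<open>(s, True)\<close> stands for the generator \<open>s\<close> and \<open>(s, False)\<close> for
  its formal inverse.
\<close>

type_synonym 's word = "('s \<times> bool) list"

definition words :: "'s set \<Rightarrow> 's word set" where
  "words S = lists (S \<times> UNIV)"

inductive pres_eq :: "'s set \<Rightarrow> ('s word \<times> 's word) set \<Rightarrow> 's word \<Rightarrow> 's word \<Rightarrow> bool"
  for S :: "'s set" and R :: "('s word \<times> 's word) set" where
  refl: "u \<in> words S \<Longrightarrow> pres_eq S R u u"
| sym: "pres_eq S R u v \<Longrightarrow> pres_eq S R v u"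
| trans: "pres_eq S R u v \<Longrightarrow> pres_eq S R v w \<Longrightarrow> pres_eq S R u w"
| cong: "pres_eq S R u u' \<Longrightarrow> pres_eq S R v v' \<Longrightarrow> pres_eq S R (u @ v) (u' @ v')"
| cancel: "s \<in> S \<Longrightarrow> pres_eq S R [(s, e), (s, \<not> e)] []"
| rel: "(u, v) \<in> R \<Longrightarrow> u \<in> words S \<Longrightarrow> v \<in> words S \<Longrightarrow> pres_eq S R u v"

definition pres_class :: "'s set \<Rightarrow> ('s word \<times> 's word) set \<Rightarrow> 's word \<Rightarrow> 's word set" where
  "pres_class S R u = {v. pres_eq S R u v}"

definition presented_group :: "'s set \<Rightarrow> ('s word \<times> 's word) set \<Rightarrow> 's word set monoid" where
  "presented_group S R =
     \<lparr>carrier = pres_class S R ` words S,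
      monoid.mult = (\<lambda>U V. \<Union>u\<in>U. \<Union>v\<in>V. pres_class S R (u @ v)),
      one = pres_class S R []\<rparr>"

section \<open>The group \<open>Q(G,B)\<close> and the map \<open>q\<close>\<close>

text \<open>
  The generators of \<open>Q(G,B)\<close> are the elements \<open>q a\<close> for \<open>a\<close> in \<open>G\<close>; the relations say exactly
  that \<open>q\<close> is quadratic relative \<open>B\<close>.  Giving a specific group, which depends on \<open>G\<close> and \<open>B\<close>
  only, makes it possible to state its universal property for target groups over an arbitrary
  type.
\<close>

definition dev_word :: "'a monoid \<Rightarrow> 'a \<Rightarrow> 'a \<Rightarrow> 'a word" where
  "dev_word G a b = [(a \<otimes>\<^bsub>G\<^esub> b, True), (b, False), (a, False)]"

definition quad_relations :: "'a monoid \<Rightarrow> 'a set \<Rightarrow> ('a word \<times> 'a word) set" where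
  "quad_relations G B =
     {(dev_word G (a \<otimes>\<^bsub>G\<^esub> b) c, dev_word G a c @ dev_word G b c) | a b c.
        a \<in> carrier G \<and> b \<in> carrier G \<and> c \<in> carrier G} \<union>
     {(dev_word G c (a \<otimes>\<^bsub>G\<^esub> b), dev_word G c a @ dev_word G c b) | a b c.
        a \<in> carrier G \<and> b \<in> carrier G \<and> c \<in> carrier G} \<union>
     {(dev_word G a b @ [(c, True)], [(c, True)] @ dev_word G a b) | a b c.
        a \<in> carrier G \<and> b \<in> carrier G \<and> c \<in> carrier G} \<union>
     {(dev_word G b a, []) | a b. a \<in> carrier G \<and> b \<in> B} \<union>
     {(dev_word G a b, []) | a b. a \<in> carrier G \<and> b \<in> B}"

definition Q_grp :: "'a monoid \<Rightarrow> 'a set \<Rightarrow> 'a word set monoid" where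
  "Q_grp G B = presented_group (carrier G) (quad_relations G B)"

definition q_map :: "'a monoid \<Rightarrow> 'a set \<Rightarrow> 'a \<Rightarrow> 'a word set" where
  "q_map G B a = pres_class (carrier G) (quad_relations G B) [(a, True)]"

definition is_hat :: "'a monoid \<Rightarrow> 'a set \<Rightarrow> 'h monoid \<Rightarrow> ('a \<Rightarrow> 'h) \<Rightarrow>
    ('a word set \<Rightarrow> 'h) \<Rightarrow> bool" where
  "is_hat G B H f h \<longleftrightarrow>
     h \<in> hom (Q_grp G B) H \<and> h \<in> extensional (carrier (Q_grp G B)) \<and>
     (\<forall>a \<in> carrier G. h (q_map G B a) = f a)"

definition hat :: "'a monoid \<Rightarrow> 'a set \<Rightarrow> 'h monoid \<Rightarrow> ('a \<Rightarrow> 'h) \<Rightarrow> 'a word set \<Rightarrow> 'h" where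
  "hat G B H f = (THE h. is_hat G B H f h)"

section \<open>Extensions and 2-cocycles\<close>

definition group_extension ::
    "'c monoid \<Rightarrow> 'e monoid \<Rightarrow> 'a monoid \<Rightarrow> ('c \<Rightarrow> 'e) \<Rightarrow> ('e \<Rightarrow> 'a) \<Rightarrow> bool" where
  "group_extension C E G i p \<longleftrightarrow>
     group C \<and> group E \<and> group G \<and>
     i \<in> mon C E \<and> i ` carrier C = kernel E G p \<and> p \<in> epi E G"

definition central_extension ::
    "'c monoid \<Rightarrow> 'e monoid \<Rightarrow> 'a monoid \<Rightarrow> ('c \<Rightarrow> 'e) \<Rightarrow> ('e \<Rightarrow> 'a) \<Rightarrow> bool" where
  "central_extension C E G i p \<longleftrightarrow>
     group_extension C E G i p \<and>
     (\<forall>c \<in> carrier C. \<forall>x \<in> carrier E. i c \<otimes>\<^bsub>E\<^esub> x = x \<otimes>\<^bsub>E\<^esub> i c)"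

definition two_cocycle :: "'a monoid \<Rightarrow> 'c monoid \<Rightarrow> ('a \<Rightarrow> 'a \<Rightarrow> 'c) \<Rightarrow> bool" where
  "two_cocycle G C D \<longleftrightarrow>
     (\<forall>a \<in> carrier G. \<forall>b \<in> carrier G. D a b \<in> carrier C) \<and>
     (\<forall>a \<in> carrier G. \<forall>b \<in> carrier G. \<forall>c \<in> carrier G.
        D a b \<otimes>\<^bsub>C\<^esub> D (a \<otimes>\<^bsub>G\<^esub> b) c = D b c \<otimes>\<^bsub>C\<^esub> D a (b \<otimes>\<^bsub>G\<^esub> c))"

definition section_of :: "'e monoid \<Rightarrow> 'a monoid \<Rightarrow> ('e \<Rightarrow> 'a) \<Rightarrow> ('a \<Rightarrow> 'e) \<Rightarrow> bool" where
  "section_of E G p s \<longleftrightarrow>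
     s \<in> carrier G \<rightarrow> carrier E \<and> (\<forall>a \<in> carrier G. p (s a) = a)"

text \<open>
  The 2-cocycle \<open>D\<close> represents the extension with inclusion \<open>i\<close> and projection \<open>p\<close> and
  corresponds to the set-theoretic section \<open>s\<close> of \<open>p\<close>.
\<close>

definition represented_by :: "'c monoid \<Rightarrow> 'e monoid \<Rightarrow> 'a monoid \<Rightarrow> ('c \<Rightarrow> 'e) \<Rightarrow>
    ('e \<Rightarrow> 'a) \<Rightarrow> ('a \<Rightarrow> 'e) \<Rightarrow> ('a \<Rightarrow> 'a \<Rightarrow> 'c) \<Rightarrow> bool" where
  "represented_by C E G i p s D \<longleftrightarrow>
     section_of E G p s \<and> two_cocycle G C D \<and>
     (\<forall>a \<in> carrier G. \<forall>b \<in> carrier G.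
        s a \<otimes>\<^bsub>E\<^esub> s b = i (D a b) \<otimes>\<^bsub>E\<^esub> s (a \<otimes>\<^bsub>G\<^esub> b))"

definition D_cocycle :: "'a monoid \<Rightarrow> 'a set \<Rightarrow> 'a \<Rightarrow> 'a \<Rightarrow>
    ('a set \<times> 'a set \<Rightarrow>\<^sub>0 int) set" where
  "D_cocycle G B a b = inv\<^bsub>T_grp G B\<^esub> bar_tens G B a b"

end

theory Submission
  imports Defs
begin

text \<open>
  Write \<open>T\<close> for \<open>G/BG' \<otimes> G/BG'\<close>, and \<open>Q\<close>, \<open>q\<close> for the group presented by the generators \<open>q a\<close> and
  the relations saying that \<open>q\<close> is quadratic relative \<open>B\<close>.

  Part (i) is the universal property of a presented group: a map from the generators to a group
  extends, uniquely, to a homomorphism as soon as it respects the relations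
  (\<open>presented_group_hom_exists\<close>, \<open>presented_group_hom_unique\<close>), and here this means that the map
  is quadratic relative \<open>B\<close> (\<open>eval_word_quad_relations\<close>).

  For part (ii), the values of the deviation \<open>d\<close> of a quadratic map commute with each other, so
  each of the two homomorphisms \<open>d(-,c)\<close> and \<open>d(c,-)\<close> vanishes on commutators.  If the map is
  quadratic relative \<open>B\<close>, then \<open>d\<close> factors through \<open>G/BG'\<close> (\<open>dev_bar_cong\<close>).  In \<open>Q\<close> the values
  of the deviation are moreover central, since they commute with the generators
  (\<open>central_Q_grpI\<close>).  So the universal property of the tensor product, for targets in the
  centre of a group (\<open>tensor_hom_exists\<close>), gives the homomorphism \<open>w: T \<rightarrow> Q\<close> and shows that its
  image is central.

  Exactness is proved by comparing \<open>Q\<close> with an explicit model \<open>E\<close>: the set \<open>T \<times> G\<close> with the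
  multiplication twisted by the bilinear cocycle \<open>D\<close>, where \<open>D(a,b)\<close> is the inverse of
  \<open>a \<otimes> b\<close>.  The map \<open>a \<mapsto> (1,a)\<close> is
  quadratic relative \<open>B\<close> with deviation \<open>(a \<otimes> b, 1)\<close> (\<open>dev_E\<close>), hence it induces a homomorphism
  \<open>\<theta>: Q \<rightarrow> E\<close> with \<open>\<theta>(w t) = (t,1)\<close> (\<open>hat_E\<close>); this makes \<open>w\<close> injective.  Conversely
  \<open>(t,a) \<mapsto> w t \<cdot> q a\<close> is a homomorphism \<open>E \<rightarrow> Q\<close>, and its composite with \<open>\<theta>\<close> fixes the generators
  of \<open>Q\<close>.  So every element of \<open>Q\<close> has the form \<open>w t \<cdot> q a\<close> (\<open>Q_decomposition\<close>); the projection to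
  \<open>G\<close> sends it to \<open>a\<close>, and \<open>q 1 = 1\<close>, so the kernel is the image of \<open>w\<close>.
\<close>

section \<open>Presented groups\<close>

text \<open>
  The value of a word in a group \<open>H\<close> when each generator \<open>s\<close> is interpreted as \<open>f s\<close>.
\<close>

fun eval_word :: "('h, 'm) monoid_scheme \<Rightarrow> ('s \<Rightarrow> 'h) \<Rightarrow> 's word \<Rightarrow> 'h" where
  "eval_word H f [] = \<one>\<^bsub>H\<^esub>"
| "eval_word H f ((s, e) # u) = (if e then f s else inv\<^bsub>H\<^esub> f s) \<otimes>\<^bsub>H\<^esub> eval_word H f u"

lemma words_simps [simp]:
  "[] \<in> words S"
  "x # u \<in> words S \<longleftrightarrow> fst x \<in> S \<and> u \<in> words S"
  "u @ v \<in> words S \<longleftrightarrow> u \<in> words S \<and> v \<in> words S"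
  by (auto simp: words_def mem_Times_iff)

lemma words_induct [consumes 1, case_names Nil Cons]:
  assumes "u \<in> words S" "P []"
    and "\<And>s e u. s \<in> S \<Longrightarrow> u \<in> words S \<Longrightarrow> P u \<Longrightarrow> P ((s, e) # u)"
  shows "P u"
  using assms(1)
proof (induction u)
  case (Cons x u)
  then show ?case using assms(3)[of "fst x" u "snd x"] by simp
qed (use assms in simp)

lemma pres_eq_words:
  assumes "pres_eq S R u v"
  shows "u \<in> words S" and "v \<in> words S"
proof -
  have "u \<in> words S \<and> v \<in> words S" using assms by induction auto
  then show "u \<in> words S" "v \<in> words S" by auto
qed

lemma pres_class_eq_iff:
  assumes "u \<in> words S"
  shows "pres_class S R u = pres_class S R v \<longleftrightarrow> pres_eq S R u v"
proof
  assume "pres_class S R u = pres_class S R v"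
  moreover have "u \<in> pres_class S R u" using assms by (simp add: pres_class_def pres_eq.refl)
  ultimately show "pres_eq S R u v" by (simp add: pres_class_def pres_eq.sym)
next
  assume "pres_eq S R u v"
  then show "pres_class S R u = pres_class S R v"
    unfolding pres_class_def by (blast intro: pres_eq.sym pres_eq.trans)
qed

lemma pres_class_rel:
  assumes "(u, v) \<in> R" "u \<in> words S" "v \<in> words S"
  shows "pres_class S R u = pres_class S R v"
  using assms by (simp add: pres_class_eq_iff pres_eq.rel)

lemma carrier_presented_group:
  "carrier (presented_group S R) = pres_class S R ` words S"
  by (simp add: presented_group_def)

lemma pres_class_closed:
  "u \<in> words S \<Longrightarrow> pres_class S R u \<in> carrier (presented_group S R)"
  by (simp add: carrier_presented_group)

lemma one_presented_group: "\<one>\<^bsub>presented_group S R\<^esub> = pres_class S R []"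
  by (simp add: presented_group_def)

lemma mult_pres_class:
  assumes "u \<in> words S" "v \<in> words S"
  shows "pres_class S R u \<otimes>\<^bsub>presented_group S R\<^esub> pres_class S R v = pres_class S R (u @ v)"
proof -
  have *: "(\<Union>v'\<in>pres_class S R v. pres_class S R (u' @ v')) = pres_class S R (u @ v)"
    if u': "u' \<in> pres_class S R u" for u'
  proof (rule SUP_eq_const)
    show "pres_class S R v \<noteq> {}"
      using assms by (auto simp: pres_class_def intro: pres_eq.refl)
    show "pres_class S R (u' @ v') = pres_class S R (u @ v)" if "v' \<in> pres_class S R v" for v'
    proof -
      have "pres_eq S R (u @ v) (u' @ v')"
        using u' that by (simp add: pres_class_def pres_eq.cong)
      then show ?thesis using assms by (metis pres_class_eq_iff words_simps(3))
    qed
  qed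
  have "(\<Union>u'\<in>pres_class S R u. \<Union>v'\<in>pres_class S R v. pres_class S R (u' @ v'))
      = pres_class S R (u @ v)"
  proof (rule SUP_eq_const)
    show "pres_class S R u \<noteq> {}"
      using assms by (auto simp: pres_class_def intro: pres_eq.refl)
  qed (rule *)
  then show ?thesis by (simp add: presented_group_def)
qed

text \<open>
  The formal inverse of a word: the letters in reverse order, each with its sign changed.
\<close>

definition inv_word :: "'s word \<Rightarrow> 's word" where
  "inv_word u = rev (map (\<lambda>(s, e). (s, \<not> e)) u)"

lemma inv_word_words: "u \<in> words S \<Longrightarrow> inv_word u \<in> words S"
  by (induction rule: words_induct) (auto simp: inv_word_def)

lemma pres_eq_inv_word:
  assumes "u \<in> words S"
  shows "pres_eq S R (inv_word u @ u) []"
  using assms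
proof (induction rule: words_induct)
  case Nil
  then show ?case by (simp add: inv_word_def pres_eq.refl)
next
  case (Cons s e u)
  have "pres_eq S R ([(s, \<not> e), (s, e)] @ u) ([] @ u)"
    using pres_eq.cancel[of s S R "\<not> e"] Cons by (intro pres_eq.cong pres_eq.refl) auto
  then have "pres_eq S R (inv_word u @ [(s, \<not> e), (s, e)] @ u) (inv_word u @ [] @ u)"
    using Cons by (intro pres_eq.cong[of S R "inv_word u"] pres_eq.refl inv_word_words)
  with Cons show ?case by (auto simp: inv_word_def intro: pres_eq.trans)
qed

lemma group_presented_group: "group (presented_group S R)"
proof (rule groupI)
  fix x assume "x \<in> carrier (presented_group S R)"
  then obtain u where u: "u \<in> words S" "x = pres_class S R u"
    by (auto simp: carrier_presented_group)
  then have "pres_class S R (inv_word u) \<otimes>\<^bsub>presented_group S R\<^esub> x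
      = \<one>\<^bsub>presented_group S R\<^esub>"
    by (simp add: mult_pres_class inv_word_words one_presented_group pres_class_eq_iff
        pres_eq_inv_word)
  with u show "\<exists>y \<in> carrier (presented_group S R).
      y \<otimes>\<^bsub>presented_group S R\<^esub> x = \<one>\<^bsub>presented_group S R\<^esub>"
    by (meson inv_word_words pres_class_closed)
qed (auto 0 0 simp: carrier_presented_group mult_pres_class one_presented_group)

lemma inv_pres_class_letter:
  assumes "s \<in> S"
  shows "inv\<^bsub>presented_group S R\<^esub> (pres_class S R [(s, True)]) = pres_class S R [(s, False)]"
proof (rule group.inv_equality[OF group_presented_group])
  show "pres_class S R [(s, False)] \<otimes>\<^bsub>presented_group S R\<^esub> pres_class S R [(s, True)]
      = \<one>\<^bsub>presented_group S R\<^esub>"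
    using assms pres_eq.cancel[OF assms, of R False]
    by (simp add: mult_pres_class one_presented_group pres_class_eq_iff)
qed (use assms in \<open>simp_all add: pres_class_closed\<close>)

lemma pres_class_Cons:
  assumes "s \<in> S" "u \<in> words S"
  shows "pres_class S R ((s, e) # u) =
    (if e then pres_class S R [(s, True)]
     else inv\<^bsub>presented_group S R\<^esub> pres_class S R [(s, True)])
    \<otimes>\<^bsub>presented_group S R\<^esub> pres_class S R u"
  using assms by (simp add: inv_pres_class_letter mult_pres_class)

lemma eval_word_closed:
  assumes "group H" "f \<in> S \<rightarrow> carrier H" "u \<in> words S"
  shows "eval_word H f u \<in> carrier H"
proof -
  interpret H: group H by fact
  show ?thesis using assms(3,2) by (induction rule: words_induct) auto
qed

lemma eval_word_append:
  assumes "group H" "f \<in> S \<rightarrow> carrier H" "u \<in> words S" "v \<in> words S"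
  shows "eval_word H f (u @ v) = eval_word H f u \<otimes>\<^bsub>H\<^esub> eval_word H f v"
proof -
  interpret H: group H by fact
  note closed = eval_word_closed[OF assms(1,2)]
  show ?thesis using assms(3,2,4)
    by (induction rule: words_induct) (auto simp: closed H.m_assoc Pi_iff)
qed

lemma eval_word_pres_eq:
  assumes "group H" "f \<in> S \<rightarrow> carrier H"
    and R: "\<And>u v. (u, v) \<in> R \<Longrightarrow> u \<in> words S \<Longrightarrow> v \<in> words S \<Longrightarrow> eval_word H f u = eval_word H f v"
    and "pres_eq S R u v"
  shows "eval_word H f u = eval_word H f v"
  using assms(4)
proof induction
  case (cong u u' v v')
  then show ?case by (metis assms(1,2) eval_word_append pres_eq_words)
next
  case (cancel s e)
  interpret H: group H by fact
  have "f s \<in> carrier H" using cancel assms(2) by auto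
  then show ?case by simp
next
  case (rel u v)
  then show ?case by (rule R)
qed simp_all

lemma presented_group_hom_exists:
  assumes "group H" "f \<in> S \<rightarrow> carrier H"
    and R: "\<And>u v. (u, v) \<in> R \<Longrightarrow> u \<in> words S \<Longrightarrow> v \<in> words S \<Longrightarrow> eval_word H f u = eval_word H f v"
  obtains h where "h \<in> hom (presented_group S R) H"
    and "\<And>s. s \<in> S \<Longrightarrow> h (pres_class S R [(s, True)]) = f s"
proof -
  interpret H: group H by fact
  define h where "h = (\<lambda>U. eval_word H f (SOME u. u \<in> U))"
  have h: "h (pres_class S R u) = eval_word H f u" if "u \<in> words S" for u
  proof -
    have "(SOME v. v \<in> pres_class S R u) \<in> pres_class S R u"
      by (rule someI[of _ u]) (simp add: pres_class_def pres_eq.refl that)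
    then show ?thesis
      using eval_word_pres_eq[OF assms] by (simp add: h_def pres_class_def)
  qed
  show thesis
  proof
    show "h \<in> hom (presented_group S R) H"
      by (rule homI)
        (auto simp: carrier_presented_group mult_pres_class h eval_word_closed[OF assms(1,2)]
          eval_word_append[OF assms(1,2)])
    show "h (pres_class S R [(s, True)]) = f s" if "s \<in> S" for s
      using that assms(2) by (auto simp: h Pi_iff)
  qed
qed

lemma presented_group_hom_unique:
  assumes "group H" "h \<in> hom (presented_group S R) H" "k \<in> hom (presented_group S R) H"
    and eq: "\<And>s. s \<in> S \<Longrightarrow> h (pres_class S R [(s, True)]) = k (pres_class S R [(s, True)])"
    and "x \<in> carrier (presented_group S R)"
  shows "h x = k x"
proof -
  interpret h: group_hom "presented_group S R" H h
    by (intro group_hom.intro group_hom_axioms.intro group_presented_group assms(1,2))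
  interpret k: group_hom "presented_group S R" H k
    by (intro group_hom.intro group_hom_axioms.intro group_presented_group assms(1,3))
  have "h (pres_class S R u) = k (pres_class S R u)" if "u \<in> words S" for u
    using that
  proof (induction rule: words_induct)
    case Nil
    then show ?case by (metis h.hom_one k.hom_one one_presented_group)
  next
    case (Cons s e u)
    have closed: "pres_class S R [(s, True)] \<in> carrier (presented_group S R)"
      "pres_class S R u \<in> carrier (presented_group S R)"
      using Cons by (auto intro: pres_class_closed)
    show ?case using closed Cons eq[of s] by (subst (1 2) pres_class_Cons) auto
  qed
  then show ?thesis using assms(5) by (auto simp: carrier_presented_group)
qed

section \<open>Quadratic maps\<close>

lemma (in group) commute_inv:
  assumes "x \<in> carrier G" "y \<in> carrier G" "x \<otimes> y = y \<otimes> x"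
  shows "x \<otimes> inv y = inv y \<otimes> x"
  using assms by (metis inv_closed inv_solve_left inv_solve_right m_assoc m_closed)

lemma (in group) commute_mult:
  assumes "x \<in> carrier G" "y \<in> carrier G" "z \<in> carrier G"
    and "x \<otimes> y = y \<otimes> x" "x \<otimes> z = z \<otimes> x"
  shows "x \<otimes> (y \<otimes> z) = (y \<otimes> z) \<otimes> x"
proof -
  have "x \<otimes> (y \<otimes> z) = (y \<otimes> x) \<otimes> z"
    using assms(1-4) by (simp flip: m_assoc)
  also have "\<dots> = y \<otimes> (z \<otimes> x)"
    using assms(1-3,5) by (simp add: m_assoc)
  finally show ?thesis using assms(1-3) by (simp add: m_assoc)
qed

lemma (in group) normal_of_derived_subset:
  assumes "subgroup N G" "derived G (carrier G) \<subseteq> N"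
  shows "N \<lhd> G"
proof -
  interpret N: subgroup N G by fact
  have "x \<otimes> h \<otimes> inv x \<in> N" if x: "x \<in> carrier G" "h \<in> N" for x h
  proof -
    have h: "h \<in> carrier G" using x(2) by (rule N.mem_carrier)
    have "x \<otimes> h \<otimes> inv x \<otimes> inv h \<in> derived_set G (carrier G)"
      using x(1) h by blast
    then have "x \<otimes> h \<otimes> inv x \<otimes> inv h \<in> N"
      using assms(2) unfolding derived_def by (blast intro: generate.incl)
    then have "x \<otimes> h \<otimes> inv x \<otimes> inv h \<otimes> h \<in> N"
      using x(2) by (rule N.m_closed)
    then show ?thesis using x(1) h by (simp add: m_assoc)
  qed
  then show ?thesis using assms(1) by (simp add: normal_inv_iff)
qed

lemma BG'_normal:
  assumes "group G" "subgroup B G"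
  shows "BG' G B \<lhd> G"
proof -
  interpret group G by fact
  have norm: "derived G (carrier G) \<lhd> G"
    by (rule derived_is_normal[OF normal_self])
  have "subgroup (BG' G B) G"
    unfolding BG'_def commut_normal[OF assms(2) norm] using norm assms(2) by (rule mult_norm_subgroup)
  moreover have "derived G (carrier G) \<subseteq> BG' G B"
  proof
    fix x assume x: "x \<in> derived G (carrier G)"
    then have "x = \<one>\<^bsub>G\<^esub> \<otimes>\<^bsub>G\<^esub> x"
      using derived_in_carrier[of "carrier G"] by auto
    with x show "x \<in> BG' G B"
      using subgroup.one_closed[OF assms(2)] unfolding BG'_def set_mult_def by blast
  qed
  ultimately show ?thesis by (rule normal_of_derived_subset)
qed

lemma (in group_hom) derived_subset_kernel:
  assumes "\<And>x y. x \<in> carrier G \<Longrightarrow> y \<in> carrier G \<Longrightarrow> h x \<otimes>\<^bsub>H\<^esub> h y = h y \<otimes>\<^bsub>H\<^esub> h x"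
  shows "derived G (carrier G) \<subseteq> kernel G H h"
  unfolding derived_def
proof (rule G.generate_subgroup_incl[OF _ subgroup_kernel])
  have "h (x \<otimes> y \<otimes> inv x \<otimes> inv y) = \<one>\<^bsub>H\<^esub>" if "x \<in> carrier G" "y \<in> carrier G" for x y
  proof -
    have "h (x \<otimes> y \<otimes> inv x \<otimes> inv y)
        = h x \<otimes>\<^bsub>H\<^esub> h y \<otimes>\<^bsub>H\<^esub> inv\<^bsub>H\<^esub> (h y \<otimes>\<^bsub>H\<^esub> h x)"
      using that by (simp add: H.m_assoc H.inv_mult_group)
    also have "\<dots> = \<one>\<^bsub>H\<^esub>" unfolding assms[OF that] using that by simp
    finally show ?thesis .
  qed
  then show "derived_set G (carrier G) \<subseteq> kernel G H h" by (auto simp: kernel_def)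
qed

text \<open>
  The deviation in multiplicative form, free of inverses: it is the unique \<open>t\<close> with
  \<open>f(ab) = t \<cdot> f(a) f(b)\<close>.
\<close>

lemma dev_eq_iff:
  assumes "group G" "group H" "f \<in> carrier G \<rightarrow> carrier H"
    and "a \<in> carrier G" "b \<in> carrier G" "t \<in> carrier H"
  shows "dev G H f a b = t \<longleftrightarrow> f (a \<otimes>\<^bsub>G\<^esub> b) = t \<otimes>\<^bsub>H\<^esub> (f a \<otimes>\<^bsub>H\<^esub> f b)"
proof -
  interpret G: group G by fact
  interpret H: group H by fact
  have [simp]: "f c \<in> carrier H" if "c \<in> carrier G" for c using assms(3) that by auto
  have "dev G H f a b = f (a \<otimes>\<^bsub>G\<^esub> b) \<otimes>\<^bsub>H\<^esub> inv\<^bsub>H\<^esub> (f a \<otimes>\<^bsub>H\<^esub> f b)"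
    using assms by (simp add: dev_def H.inv_mult_group H.m_assoc)
  then show ?thesis
    using assms H.inv_solve_right[of t "f (a \<otimes>\<^bsub>G\<^esub> b)" "f a \<otimes>\<^bsub>H\<^esub> f b"] by auto
qed

lemma dev_closed:
  assumes "group G" "group H" "f \<in> carrier G \<rightarrow> carrier H" "a \<in> carrier G" "b \<in> carrier G"
  shows "dev G H f a b \<in> carrier H"
proof -
  interpret G: group G by fact
  interpret H: group H by fact
  show ?thesis using assms(3-5) by (auto simp: dev_def Pi_iff)
qed

lemma quadratic_rel_of_hom:
  assumes "group G" "group H" "subgroup B G" "f \<in> hom G H"
  shows "quadratic_rel G B H f"
proof -
  interpret f: group_hom G H f
    using assms by (simp add: group_hom_def group_hom_axioms_def)
  have "dev G H f a b = \<one>\<^bsub>H\<^esub>" if "a \<in> carrier G" "b \<in> carrier G" for a b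
    using that by (subst dev_eq_iff) (auto simp: f.G.is_group f.H.is_group)
  moreover have "B \<subseteq> carrier G" using assms(3) by (rule subgroup.subset)
  ultimately show ?thesis
    by (auto simp: quadratic_rel_def quadratic_def bilinear_map_def hom_def subset_iff)
qed

text \<open>
  The second deviation is a product of values of \<open>f\<close> and their inverses, and the first one
  commutes with all of these.
\<close>

lemma dev_commute:
  assumes "group G" "group H" "quadratic G H f"
    and "a \<in> carrier G" "b \<in> carrier G" "c \<in> carrier G" "d \<in> carrier G"
  shows "dev G H f a b \<otimes>\<^bsub>H\<^esub> dev G H f c d = dev G H f c d \<otimes>\<^bsub>H\<^esub> dev G H f a b"
proof -
  interpret G: group G by fact
  interpret H: group H by fact
  have f: "f \<in> carrier G \<rightarrow> carrier H" using assms(3) by (simp add: quadratic_def)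
  have [simp]: "f x \<in> carrier H" if "x \<in> carrier G" for x using f that by auto
  have "dev G H f a b \<otimes>\<^bsub>H\<^esub> f x = f x \<otimes>\<^bsub>H\<^esub> dev G H f a b" if "x \<in> carrier G" for x
    using assms(3-5) that by (simp add: quadratic_def)
  with assms dev_closed[OF assms(1,2) f assms(4,5)] show ?thesis
    unfolding dev_def[of G H f c d] by (intro H.commute_mult H.commute_inv) auto
qed

lemma dev_BG':
  assumes "group G" "group H" "subgroup B G" "quadratic_rel G B H f"
    and "x \<in> BG' G B" "c \<in> carrier G"
  shows "dev G H f x c = \<one>\<^bsub>H\<^esub>" and "dev G H f c x = \<one>\<^bsub>H\<^esub>"
proof -
  interpret G: group G by fact
  interpret H: group H by fact
  have f: "quadratic G H f" "bilinear_map G H (dev G H f)"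
    using assms(4) by (auto simp: quadratic_rel_def quadratic_def)
  have B: "dev G H f b c = \<one>\<^bsub>H\<^esub>" "dev G H f c b = \<one>\<^bsub>H\<^esub>" if "b \<in> B" for b
    using assms(4,6) that by (auto simp: quadratic_rel_def)
  obtain b g where x: "b \<in> B" "g \<in> derived G (carrier G)" "x = b \<otimes>\<^bsub>G\<^esub> g"
    using assms(5) by (auto simp: BG'_def set_mult_def)
  have carr: "b \<in> carrier G" "g \<in> carrier G"
    using x assms(3) G.derived_in_carrier[of "carrier G"] by (auto dest: subgroup.mem_carrier)
  interpret l: group_hom G H "\<lambda>a. dev G H f a c"
    using f(2) assms(6) by unfold_locales (simp add: bilinear_map_def)
  interpret r: group_hom G H "\<lambda>a. dev G H f c a"
    using f(2) assms(6) by unfold_locales (simp add: bilinear_map_def)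
  have "g \<in> kernel G H (\<lambda>a. dev G H f a c)"
    using l.derived_subset_kernel dev_commute[OF assms(1,2) f(1)] assms(6) x(2) by blast
  then show "dev G H f x c = \<one>\<^bsub>H\<^esub>"
    using carr x B by (simp add: kernel_def)
  have "g \<in> kernel G H (\<lambda>a. dev G H f c a)"
    using r.derived_subset_kernel dev_commute[OF assms(1,2) f(1)] assms(6) x(2) by blast
  then show "dev G H f c x = \<one>\<^bsub>H\<^esub>"
    using carr x B by (simp add: kernel_def)
qed

text \<open>
  The deviation descends to \<open>G/BG' \<times> G/BG'\<close>.
\<close>

lemma dev_bar_cong:
  assumes "group G" "group H" "subgroup B G" "quadratic_rel G B H f"
    and "a \<in> carrier G" "a' \<in> carrier G" "b \<in> carrier G" "b' \<in> carrier G"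
    and "bar G B a = bar G B a'" "bar G B b = bar G B b'"
  shows "dev G H f a b = dev G H f a' b'"
proof -
  interpret G: group G by fact
  interpret H: group H by fact
  interpret N: normal "BG' G B" G using BG'_normal[OF assms(1,3)] .
  have f: "bilinear_map G H (dev G H f)"
    using assms(4) by (auto simp: quadratic_rel_def quadratic_def)
  have rep: "\<exists>n \<in> BG' G B. x = n \<otimes>\<^bsub>G\<^esub> y"
    if "x \<in> carrier G" "bar G B x = bar G B y" for x y
    using that G.rcos_self[OF that(1) N.subgroup_axioms] by (auto simp: bar_def r_coset_def)
  obtain n m where n: "n \<in> BG' G B" "a = n \<otimes>\<^bsub>G\<^esub> a'" and m: "m \<in> BG' G B" "b = m \<otimes>\<^bsub>G\<^esub> b'"
    using rep assms(5-10) by meson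
  interpret l: group_hom G H "\<lambda>a. dev G H f a b"
    using f assms(7) by unfold_locales (simp add: bilinear_map_def)
  interpret r: group_hom G H "\<lambda>b. dev G H f a' b"
    using f assms(6) by unfold_locales (simp add: bilinear_map_def)
  have "dev G H f a b = dev G H f a' b"
    using n assms(6) l.hom_mult[of n a'] l.hom_closed[of a'] dev_BG'[OF assms(1-4) n(1) assms(7)]
    by simp
  also have "\<dots> = dev G H f a' b'"
    using m assms(8) r.hom_mult[of m b'] r.hom_closed[of b'] dev_BG'[OF assms(1-4) m(1) assms(6)]
    by simp
  finally show ?thesis .
qed

section \<open>Tensor products\<close>

lemma tensor_relators_subset:
  fixes M :: "'a monoid" and N :: "'b monoid"
  assumes "group M" "group N"
  shows "tensor_relators M N \<subseteq> carrier (free_Abelian_group (carrier M \<times> carrier N))"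
proof -
  interpret M: group M by fact
  interpret N: group N by fact
  have diff: "u - v \<in> carrier (free_Abelian_group S)"
    if "u \<in> carrier (free_Abelian_group S)" "v \<in> carrier (free_Abelian_group S)"
    for u v :: "'a \<times> 'b \<Rightarrow>\<^sub>0 int" and S
    using that keys_diff[of u v] by auto
  show ?thesis
    unfolding tensor_relators_def by (auto intro!: diff simp del: carrier_free_Abelian_group_iff)
qed

lemma tensor_kernel_subgroup:
  assumes "group M" "group N"
  shows "subgroup (tensor_kernel M N) (free_Abelian_group (carrier M \<times> carrier N))"
  unfolding tensor_kernel_def
  using tensor_relators_subset[OF assms] by (intro group.generate_is_subgroup) auto

lemma tensor_kernel_normal:
  assumes "group M" "group N"
  shows "tensor_kernel M N \<lhd> free_Abelian_group (carrier M \<times> carrier N)"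
  using tensor_kernel_subgroup[OF assms]
  by (simp add: comm_group.normal_iff_subgroup abelian_free_Abelian_group)

lemma comm_group_tensor:
  assumes "group M" "group N"
  shows "comm_group (tensor M N)"
  unfolding tensor_def using tensor_kernel_subgroup[OF assms]
  by (intro comm_group.abelian_FactGroup abelian_free_Abelian_group)

lemma tensor_projection_hom:
  assumes "group M" "group N"
  shows "(\<lambda>u. tensor_kernel M N #>\<^bsub>free_Abelian_group (carrier M \<times> carrier N)\<^esub> u)
    \<in> hom (free_Abelian_group (carrier M \<times> carrier N)) (tensor M N)"
  unfolding tensor_def using tensor_kernel_normal[OF assms] by (rule normal.r_coset_hom_Mod)

lemma tens_closed:
  assumes "group M" "group N" "x \<in> carrier M" "y \<in> carrier N"
  shows "tens M N x y \<in> carrier (tensor M N)"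
  unfolding tens_def using hom_in_carrier[OF tensor_projection_hom[OF assms(1,2)]] assms(3,4) by simp

text \<open>
  The projection \<open>\<pi>\<close> from the free abelian group to the tensor product turns a relator
  \<open>u - v - w\<close> into the equation \<open>\<pi> u = \<pi> v \<cdot> \<pi> w\<close>; the bilinearity of \<open>tens\<close> is the case of
  the two kinds of relators.
\<close>

lemma tensor_projection_relator:
  assumes "group M" "group N" "u - v - w \<in> tensor_relators M N"
    and "u \<in> carrier (free_Abelian_group (carrier M \<times> carrier N))"
    and "v \<in> carrier (free_Abelian_group (carrier M \<times> carrier N))"
    and "w \<in> carrier (free_Abelian_group (carrier M \<times> carrier N))"
  defines "\<pi> \<equiv> \<lambda>u. tensor_kernel M N #>\<^bsub>free_Abelian_group (carrier M \<times> carrier N)\<^esub> u"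
  shows "\<pi> u = \<pi> v \<otimes>\<^bsub>tensor M N\<^esub> \<pi> w"
proof -
  let ?F = "free_Abelian_group (carrier M \<times> carrier N)"
  interpret F: group ?F by simp
  interpret K: subgroup "tensor_kernel M N" ?F using assms(1,2) by (rule tensor_kernel_subgroup)
  have k: "u - v - w \<in> tensor_kernel M N"
    using assms(3) by (auto simp: tensor_kernel_def intro: generate.incl)
  have vw: "v \<otimes>\<^bsub>?F\<^esub> w \<in> carrier ?F" using assms(5,6) by (rule F.m_closed)
  have "u = (u - v - w) \<otimes>\<^bsub>?F\<^esub> (v \<otimes>\<^bsub>?F\<^esub> w)" by simp
  then have "u \<in> \<pi> (v \<otimes>\<^bsub>?F\<^esub> w)"
    unfolding \<pi>_def r_coset_def using k by blast
  then have "\<pi> u = \<pi> (v \<otimes>\<^bsub>?F\<^esub> w)"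
    unfolding \<pi>_def using F.repr_independence[OF _ vw K.subgroup_axioms] by simp
  also have "\<dots> = \<pi> v \<otimes>\<^bsub>tensor M N\<^esub> \<pi> w"
    unfolding \<pi>_def using hom_mult[OF tensor_projection_hom[OF assms(1,2)] assms(5,6)] .
  finally show ?thesis .
qed

lemma tens_mult_left:
  assumes "group M" "group N" "x \<in> carrier M" "x' \<in> carrier M" "y \<in> carrier N"
  shows "tens M N (x \<otimes>\<^bsub>M\<^esub> x') y = tens M N x y \<otimes>\<^bsub>tensor M N\<^esub> tens M N x' y"
proof -
  interpret M: group M by fact
  show ?thesis unfolding tens_def
    using assms by (intro tensor_projection_relator) (auto simp: tensor_relators_def)
qed

lemma tens_mult_right:
  assumes "group M" "group N" "x \<in> carrier M" "y \<in> carrier N" "y' \<in> carrier N"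
  shows "tens M N x (y \<otimes>\<^bsub>N\<^esub> y') = tens M N x y \<otimes>\<^bsub>tensor M N\<^esub> tens M N x y'"
proof -
  interpret N: group N by fact
  show ?thesis unfolding tens_def
    using assms by (intro tensor_projection_relator) (auto simp: tensor_relators_def)
qed

text \<open>
  Homomorphisms to an arbitrary group, not only to an abelian one, are determined by their values
  on the elementary tensors.
\<close>

lemma tensor_hom_unique:
  assumes "group M" "group N" "group H" "h \<in> hom (tensor M N) H" "k \<in> hom (tensor M N) H"
    and eq: "\<And>x y. x \<in> carrier M \<Longrightarrow> y \<in> carrier N \<Longrightarrow> h (tens M N x y) = k (tens M N x y)"
    and "t \<in> carrier (tensor M N)"
  shows "h t = k t"
proof -
  let ?F = "free_Abelian_group (carrier M \<times> carrier N)"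
  define \<pi> where "\<pi> = (\<lambda>u. tensor_kernel M N #>\<^bsub>?F\<^esub> u)"
  have \<pi>: "\<pi> \<in> hom ?F (tensor M N)"
    unfolding \<pi>_def by (rule tensor_projection_hom[OF assms(1,2)])
  interpret F: group ?F by simp
  interpret T: comm_group "tensor M N" by (rule comm_group_tensor[OF assms(1,2)])
  interpret H: group H by fact
  interpret h: group_hom ?F H "h \<circ> \<pi>"
    using Group.hom_compose[OF \<pi> assms(4)] by unfold_locales
  interpret k: group_hom ?F H "k \<circ> \<pi>"
    using Group.hom_compose[OF \<pi> assms(5)] by unfold_locales
  have "(h \<circ> \<pi>) u = (k \<circ> \<pi>) u" if "Poly_Mapping.keys u \<subseteq> carrier M \<times> carrier N" for u
    using that
  proof (induction rule: free_Abelian_group_induct[consumes 1, case_names zero diff gen])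
    case zero
    then show ?case using h.hom_one k.hom_one by simp
  next
    case (diff u v)
    have "u - v = u \<otimes>\<^bsub>?F\<^esub> inv\<^bsub>?F\<^esub> v" using diff by simp
    moreover have "u \<in> carrier ?F" "v \<in> carrier ?F" using diff by auto
    ultimately show ?case using diff
      by (metis F.inv_closed h.hom_inv h.hom_mult k.hom_inv k.hom_mult)
  next
    case (gen a)
    then show ?case using eq by (cases a) (auto simp: \<pi>_def tens_def)
  qed
  moreover obtain u where "u \<in> carrier ?F" "t = \<pi> u"
    using assms(7) by (auto simp: tensor_def FactGroup_def RCOSETS_def \<pi>_def)
  ultimately show ?thesis by simp
qed

lemma tensor_hom_exists_comm:
  assumes "group M" "group N" "comm_group H"
    and closed: "\<And>x y. x \<in> carrier M \<Longrightarrow> y \<in> carrier N \<Longrightarrow> \<phi> x y \<in> carrier H"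
    and left: "\<And>x x' y. x \<in> carrier M \<Longrightarrow> x' \<in> carrier M \<Longrightarrow> y \<in> carrier N \<Longrightarrow>
      \<phi> (x \<otimes>\<^bsub>M\<^esub> x') y = \<phi> x y \<otimes>\<^bsub>H\<^esub> \<phi> x' y"
    and right: "\<And>x y y'. x \<in> carrier M \<Longrightarrow> y \<in> carrier N \<Longrightarrow> y' \<in> carrier N \<Longrightarrow>
      \<phi> x (y \<otimes>\<^bsub>N\<^esub> y') = \<phi> x y \<otimes>\<^bsub>H\<^esub> \<phi> x y'"
  obtains h where "h \<in> hom (tensor M N) H"
    and "\<And>x y. x \<in> carrier M \<Longrightarrow> y \<in> carrier N \<Longrightarrow> h (tens M N x y) = \<phi> x y"
proof -
  let ?F = "free_Abelian_group (carrier M \<times> carrier N)"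
  interpret M: group M by fact
  interpret N: group N by fact
  interpret H: comm_group H by fact
  interpret F: group ?F by simp
  obtain g where g: "g \<in> hom ?F H"
    and g_of: "\<And>z. z \<in> carrier M \<times> carrier N \<Longrightarrow> g (frag_of z) = case_prod \<phi> z"
  proof (rule H.free_Abelian_group_universal[of "case_prod \<phi>" "carrier M \<times> carrier N"])
    show "case_prod \<phi> ` (carrier M \<times> carrier N) \<subseteq> carrier H" using closed by auto
  qed blast
  interpret g: group_hom ?F H g using g by unfold_locales
  have diff: "g (u - v - w) = \<one>\<^bsub>H\<^esub>"
    if "u \<in> carrier ?F" "v \<in> carrier ?F" "w \<in> carrier ?F" "g u = g v \<otimes>\<^bsub>H\<^esub> g w" for u v w
  proof -
    have "u - v - w = u \<otimes>\<^bsub>?F\<^esub> inv\<^bsub>?F\<^esub> (v \<otimes>\<^bsub>?F\<^esub> w)"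
      using F.m_closed[OF that(2,3)] by simp
    then show ?thesis using that F.m_closed[OF that(2,3)]
      by (metis F.inv_closed H.r_inv g.hom_closed g.hom_inv g.hom_mult)
  qed
  have "tensor_relators M N \<subseteq> kernel ?F H g"
  proof
    fix z assume z: "z \<in> tensor_relators M N"
    have "g z = \<one>\<^bsub>H\<^esub>"
      using z unfolding tensor_relators_def
      by (auto intro!: diff simp: g_of left right simp del: mult_free_Abelian_group)
    moreover have "z \<in> carrier ?F" using z tensor_relators_subset[OF assms(1,2)] by blast
    ultimately show "z \<in> kernel ?F H g" by (simp add: kernel_def)
  qed
  then have "tensor_kernel M N \<subseteq> kernel ?F H g"
    unfolding tensor_kernel_def by (rule F.generate_subgroup_incl[OF _ g.subgroup_kernel])
  then obtain h where h: "h \<in> hom (tensor M N) H"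
    and "\<And>u. u \<in> carrier ?F \<Longrightarrow> h (tensor_kernel M N #>\<^bsub>?F\<^esub> u) = g u"
    using g.FactGroup_universal_kernel[OF tensor_kernel_normal[OF assms(1,2)]]
    unfolding tensor_def by metis
  then show thesis using that[OF h] g_of by (simp add: tens_def)
qed

text \<open>
  The centre of a group.
\<close>

definition centre :: "('h, 'm) monoid_scheme \<Rightarrow> 'h set" where
  "centre H = {z \<in> carrier H. \<forall>x \<in> carrier H. z \<otimes>\<^bsub>H\<^esub> x = x \<otimes>\<^bsub>H\<^esub> z}"

lemma centreI:
  "z \<in> carrier H \<Longrightarrow> (\<And>x. x \<in> carrier H \<Longrightarrow> z \<otimes>\<^bsub>H\<^esub> x = x \<otimes>\<^bsub>H\<^esub> z) \<Longrightarrow> z \<in> centre H"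
  by (simp add: centre_def)

lemma centre_carrier: "z \<in> centre H \<Longrightarrow> z \<in> carrier H"
  by (simp add: centre_def)

lemma centre_commute:
  "z \<in> centre H \<Longrightarrow> x \<in> carrier H \<Longrightarrow> z \<otimes>\<^bsub>H\<^esub> x = x \<otimes>\<^bsub>H\<^esub> z"
  by (simp add: centre_def)

lemma (in group) centre_subgroup: "subgroup (centre G) G"
proof (rule subgroupI)
  show "inv z \<in> centre G" if "z \<in> centre G" for z
  proof (rule centreI)
    show "inv z \<otimes> x = x \<otimes> inv z" if "x \<in> carrier G" for x
      using commute_inv[OF that centre_carrier[OF \<open>z \<in> centre G\<close>]]
        centre_commute[OF \<open>z \<in> centre G\<close> that] by simp
  qed (use that in \<open>simp add: centre_carrier\<close>)
  show "y \<otimes> z \<in> centre G" if y: "y \<in> centre G" and z: "z \<in> centre G" for y z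
  proof (rule centreI)
    show "y \<otimes> z \<otimes> x = x \<otimes> (y \<otimes> z)" if x: "x \<in> carrier G" for x
      using commute_mult[OF x centre_carrier[OF y] centre_carrier[OF z]
          centre_commute[OF y x, symmetric] centre_commute[OF z x, symmetric]] by simp
  qed (use y z in \<open>simp add: centre_carrier\<close>)
  show "centre G \<noteq> {}"
    using centreI[of \<one> G] by auto
qed (simp add: centre_def)

lemma (in group) comm_group_centre: "comm_group (G\<lparr>carrier := centre G\<rparr>)"
  using subgroup.subgroup_is_group[OF centre_subgroup is_group]
  by (rule group.group_comm_groupI) (simp add: centre_carrier centre_commute)

text \<open>
  The universal property of the tensor product for a non-abelian target \<open>H\<close>, which requires the
  values of the bilinear map to be central.
\<close>

lemma tensor_hom_exists:
  assumes "group M" "group N" "group H"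
    and closed: "\<And>x y. x \<in> carrier M \<Longrightarrow> y \<in> carrier N \<Longrightarrow> \<phi> x y \<in> centre H"
    and left: "\<And>x x' y. x \<in> carrier M \<Longrightarrow> x' \<in> carrier M \<Longrightarrow> y \<in> carrier N \<Longrightarrow>
      \<phi> (x \<otimes>\<^bsub>M\<^esub> x') y = \<phi> x y \<otimes>\<^bsub>H\<^esub> \<phi> x' y"
    and right: "\<And>x y y'. x \<in> carrier M \<Longrightarrow> y \<in> carrier N \<Longrightarrow> y' \<in> carrier N \<Longrightarrow>
      \<phi> x (y \<otimes>\<^bsub>N\<^esub> y') = \<phi> x y \<otimes>\<^bsub>H\<^esub> \<phi> x y'"
  obtains h where "h \<in> hom (tensor M N) H" "h ` carrier (tensor M N) \<subseteq> centre H"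
    and "\<And>x y. x \<in> carrier M \<Longrightarrow> y \<in> carrier N \<Longrightarrow> h (tens M N x y) = \<phi> x y"
proof -
  let ?Z = "H\<lparr>carrier := centre H\<rparr>"
  obtain h where h: "h \<in> hom (tensor M N) ?Z"
    and eq: "\<And>x y. x \<in> carrier M \<Longrightarrow> y \<in> carrier N \<Longrightarrow> h (tens M N x y) = \<phi> x y"
    using tensor_hom_exists_comm[OF assms(1,2) group.comm_group_centre[OF assms(3)], of \<phi>]
      closed left right by auto
  show thesis
  proof
    show "h \<in> hom (tensor M N) H" "h ` carrier (tensor M N) \<subseteq> centre H"
      using h centre_carrier[of _ H] by (auto simp: hom_def)
  qed (rule eq)
qed

section \<open>The universal quadratic map\<close>

lemma hom_dev:
  assumes "group K" "group G" "group H" "h \<in> hom G H" "f \<in> carrier K \<rightarrow> carrier G"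
    and "a \<in> carrier K" "b \<in> carrier K"
  shows "h (dev K G f a b) = dev K H (h \<circ> f) a b"
proof -
  interpret K: group K by fact
  interpret h: group_hom G H h
    by (intro group_hom.intro group_hom_axioms.intro assms(2-4))
  have [simp]: "f c \<in> carrier G" if "c \<in> carrier K" for c using assms(5) that by auto
  show ?thesis using assms(6,7) by (simp add: dev_def)
qed

lemma dev_word_words:
  assumes "group G" "a \<in> carrier G" "b \<in> carrier G"
  shows "dev_word G a b \<in> words (carrier G)"
proof -
  interpret G: group G by fact
  show ?thesis using assms by (simp add: dev_word_def)
qed

lemma eval_dev_word:
  assumes "group G" "group H" "f \<in> carrier G \<rightarrow> carrier H" "a \<in> carrier G" "b \<in> carrier G"
  shows "eval_word H f (dev_word G a b) = dev G H f a b"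
proof -
  interpret G: group G by fact
  interpret H: group H by fact
  have [simp]: "f c \<in> carrier H" if "c \<in> carrier G" for c using assms(3) that by auto
  show ?thesis using assms(4,5) by (simp add: dev_word_def dev_def H.m_assoc)
qed

lemma group_Q_grp: "group (Q_grp G B)"
  by (simp add: Q_grp_def group_presented_group)

lemma q_map_closed: "q_map G B \<in> carrier G \<rightarrow> carrier (Q_grp G B)"
  by (simp add: q_map_def Q_grp_def pres_class_closed)

lemma Q_grp_hom_unique:
  assumes "group H" "h \<in> hom (Q_grp G B) H" "k \<in> hom (Q_grp G B) H"
    and "\<And>a. a \<in> carrier G \<Longrightarrow> h (q_map G B a) = k (q_map G B a)"
    and "x \<in> carrier (Q_grp G B)"
  shows "h x = k x"
  using presented_group_hom_unique[OF assms(1), of h "carrier G" "quad_relations G B" k x] assms(2-5)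
  by (simp add: Q_grp_def q_map_def)

text \<open>
  An element that commutes with the generators \<open>q c\<close> is central.
\<close>

lemma central_Q_grpI:
  assumes "z \<in> carrier (Q_grp G B)"
    and q: "\<And>c. c \<in> carrier G \<Longrightarrow>
      z \<otimes>\<^bsub>Q_grp G B\<^esub> q_map G B c = q_map G B c \<otimes>\<^bsub>Q_grp G B\<^esub> z"
  shows "z \<in> centre (Q_grp G B)"
proof -
  interpret Q: group "Q_grp G B" by (rule group_Q_grp)
  let ?cl = "pres_class (carrier G) (quad_relations G B)"
  have "z \<otimes>\<^bsub>Q_grp G B\<^esub> ?cl u = ?cl u \<otimes>\<^bsub>Q_grp G B\<^esub> z" if "u \<in> words (carrier G)" for u
    using that
  proof (induction rule: words_induct)
    case Nil
    have "?cl [] = \<one>\<^bsub>Q_grp G B\<^esub>" by (simp add: Q_grp_def one_presented_group)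
    then show ?case using assms(1) by simp
  next
    case (Cons s e u)
    have s: "q_map G B s \<in> carrier (Q_grp G B)" using Cons(1) q_map_closed[of G B] by auto
    have u: "?cl u \<in> carrier (Q_grp G B)"
      using Cons(2) by (simp add: Q_grp_def pres_class_closed)
    have "?cl ((s, e) # u) = (if e then q_map G B s else inv\<^bsub>Q_grp G B\<^esub> q_map G B s)
        \<otimes>\<^bsub>Q_grp G B\<^esub> ?cl u"
      unfolding Q_grp_def q_map_def by (rule pres_class_Cons[OF Cons(1,2)])
    then show ?case
      using Q.commute_mult[OF assms(1) _ u _ Cons.IH] Q.commute_inv[OF assms(1) s q] q Cons(1) s
      by simp
  qed
  then show ?thesis
    using assms(1) by (intro centreI) (auto simp: Q_grp_def carrier_presented_group)
qed

lemma quadratic_rel_q_map: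
  assumes "group G" "subgroup B G"
  shows "quadratic_rel G B (Q_grp G B) (q_map G B)"
proof -
  interpret G: group G by fact
  interpret Q: group "Q_grp G B" by (rule group_Q_grp)
  let ?cl = "pres_class (carrier G) (quad_relations G B)" and ?d = "dev G (Q_grp G B) (q_map G B)"
  note [simp] = dev_word_words[OF assms(1)]
  have BG: "b \<in> carrier G" if "b \<in> B" for b using assms(2) that by (rule subgroup.mem_carrier)
  have q: "?cl [(c, True)] = q_map G B c" for c by (simp add: q_map_def)
  have mult: "?cl (u @ v) = ?cl u \<otimes>\<^bsub>Q_grp G B\<^esub> ?cl v"
    if "u \<in> words (carrier G)" "v \<in> words (carrier G)" for u v
    using that by (simp add: Q_grp_def mult_pres_class)
  have d: "?cl (dev_word G a b) = ?d a b" if "a \<in> carrier G" "b \<in> carrier G" for a b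
  proof -
    have "?cl (dev_word G a b) = ?cl [(a \<otimes>\<^bsub>G\<^esub> b, True)] \<otimes>\<^bsub>Q_grp G B\<^esub>
        (?cl [(b, False)] \<otimes>\<^bsub>Q_grp G B\<^esub> ?cl [(a, False)])"
      using that mult[of "[(b, False)]" "[(a, False)]"]
        mult[of "[(a \<otimes>\<^bsub>G\<^esub> b, True)]" "[(b, False), (a, False)]"]
      by (simp add: dev_word_def)
    moreover have "?cl [(c, False)] = inv\<^bsub>Q_grp G B\<^esub> q_map G B c" if "c \<in> carrier G" for c
      using that by (simp add: Q_grp_def q_map_def inv_pres_class_letter)
    moreover have "q_map G B c \<in> carrier (Q_grp G B)" if "c \<in> carrier G" for c
      using that q_map_closed[of G B] by auto
    ultimately show ?thesis
      using that by (simp add: dev_def q Q.m_assoc)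
  qed
  have closed: "?d a b \<in> carrier (Q_grp G B)" if "a \<in> carrier G" "b \<in> carrier G" for a b
    using dev_closed[OF assms(1) group_Q_grp q_map_closed that] .
  have rel: "?cl u = ?cl v"
    if "(u, v) \<in> quad_relations G B" "u \<in> words (carrier G)" "v \<in> words (carrier G)" for u v
    using that by (rule pres_class_rel)
  have "?d (a \<otimes>\<^bsub>G\<^esub> b) c = ?d a c \<otimes>\<^bsub>Q_grp G B\<^esub> ?d b c"
    if c: "a \<in> carrier G" "b \<in> carrier G" "c \<in> carrier G" for a b c
  proof -
    have "?cl (dev_word G (a \<otimes>\<^bsub>G\<^esub> b) c) = ?cl (dev_word G a c @ dev_word G b c)"
      using c by (intro rel) (auto simp: quad_relations_def)
    then show ?thesis using c by (simp add: mult d)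
  qed
  moreover have "?d c (a \<otimes>\<^bsub>G\<^esub> b) = ?d c a \<otimes>\<^bsub>Q_grp G B\<^esub> ?d c b"
    if c: "a \<in> carrier G" "b \<in> carrier G" "c \<in> carrier G" for a b c
  proof -
    have "?cl (dev_word G c (a \<otimes>\<^bsub>G\<^esub> b)) = ?cl (dev_word G c a @ dev_word G c b)"
      using c by (intro rel) (auto simp: quad_relations_def)
    then show ?thesis using c by (simp add: mult d)
  qed
  moreover have "?d a b \<otimes>\<^bsub>Q_grp G B\<^esub> q_map G B c = q_map G B c \<otimes>\<^bsub>Q_grp G B\<^esub> ?d a b"
    if c: "a \<in> carrier G" "b \<in> carrier G" "c \<in> carrier G" for a b c
  proof -
    have "?cl (dev_word G a b @ [(c, True)]) = ?cl ([(c, True)] @ dev_word G a b)"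
      using c by (intro rel) (auto simp: quad_relations_def)
    then show ?thesis using c by (simp add: mult d q del: append_Cons)
  qed
  moreover have "?d b a = \<one>\<^bsub>Q_grp G B\<^esub>" "?d a b = \<one>\<^bsub>Q_grp G B\<^esub>"
    if c: "b \<in> B" "a \<in> carrier G" for a b
  proof -
    have "(dev_word G b a, []) \<in> quad_relations G B" "(dev_word G a b, []) \<in> quad_relations G B"
      using c unfolding quad_relations_def by blast+
    then have "?cl (dev_word G b a) = ?cl []" "?cl (dev_word G a b) = ?cl []"
      using c BG by (auto dest: rel)
    moreover have "?cl [] = \<one>\<^bsub>Q_grp G B\<^esub>" by (simp add: Q_grp_def one_presented_group)
    ultimately show "?d b a = \<one>\<^bsub>Q_grp G B\<^esub>" "?d a b = \<one>\<^bsub>Q_grp G B\<^esub>"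
      using c BG by (auto simp: d)
  qed
  ultimately show ?thesis
    unfolding quadratic_rel_def quadratic_def bilinear_map_def
    by (auto simp: hom_def closed q_map_closed)
qed

text \<open>
  A map that is quadratic relative \<open>B\<close> respects the defining relations of \<open>Q(G,B)\<close>.
\<close>

lemma eval_word_quad_relations:
  assumes "group G" "subgroup B G" "group H" "quadratic_rel G B H f"
    and "(u, v) \<in> quad_relations G B"
  shows "eval_word H f u = eval_word H f v"
proof -
  interpret G: group G by fact
  interpret H: group H by fact
  have f: "f \<in> carrier G \<rightarrow> carrier H" and bil: "bilinear_map G H (dev G H f)"
    and fcomm: "\<And>a b c. a \<in> carrier G \<Longrightarrow> b \<in> carrier G \<Longrightarrow> c \<in> carrier G \<Longrightarrow>
      dev G H f a b \<otimes>\<^bsub>H\<^esub> f c = f c \<otimes>\<^bsub>H\<^esub> dev G H f a b"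
    and frel: "\<And>a b. b \<in> B \<Longrightarrow> a \<in> carrier G \<Longrightarrow> dev G H f b a = \<one>\<^bsub>H\<^esub>"
      "\<And>a b. b \<in> B \<Longrightarrow> a \<in> carrier G \<Longrightarrow> dev G H f a b = \<one>\<^bsub>H\<^esub>"
    using assms(4) by (auto simp: quadratic_rel_def quadratic_def)
  have [simp]: "f c \<in> carrier H" if "c \<in> carrier G" for c using f that by auto
  have BG: "b \<in> carrier G" if "b \<in> B" for b using assms(2) that by (rule subgroup.mem_carrier)
  note [simp] = dev_word_words[OF assms(1)] eval_dev_word[OF assms(1,3) f]
    eval_word_append[OF assms(3) f]
  from assms(5) show ?thesis
    unfolding quad_relations_def
  proof (elim UnE CollectE exE conjE, goal_cases)
    case (1 a b c)
    then have "(\<lambda>a. dev G H f a c) \<in> hom G H" using bil by (simp add: bilinear_map_def)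
    from hom_mult[OF this] 1 show ?case by simp
  next
    case (2 a b c)
    then have "dev G H f c \<in> hom G H" using bil by (simp add: bilinear_map_def)
    from hom_mult[OF this] 2 show ?case by simp
  next
    case (3 a b c)
    then show ?case using fcomm[of a b c] by (simp del: append_Cons)
  next
    case (4 a b)
    then show ?case using frel[of b a] BG by simp
  next
    case (5 a b)
    then show ?case using frel[of b a] BG by simp
  qed
qed

lemma ex1_is_hat:
  assumes "group G" "subgroup B G" "group H" "quadratic_rel G B H f"
  shows "\<exists>!h. is_hat G B H f h"
proof (rule ex_ex1I)
  let ?Q = "Q_grp G B"
  have f: "f \<in> carrier G \<rightarrow> carrier H"
    using assms(4) by (simp add: quadratic_rel_def quadratic_def)
  obtain h where h: "h \<in> hom ?Q H" "\<And>a. a \<in> carrier G \<Longrightarrow> h (q_map G B a) = f a"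
    using presented_group_hom_exists[OF assms(3) f eval_word_quad_relations[OF assms]]
    unfolding Q_grp_def q_map_def by blast
  have "restrict h (carrier ?Q) \<in> hom ?Q H"
    using h(1) by (rule group.hom_restrict[OF group_Q_grp]) simp
  moreover have "restrict h (carrier ?Q) (q_map G B a) = f a" if "a \<in> carrier G" for a
    using h(2)[OF that] that q_map_closed[of G B] by (simp add: Pi_iff)
  ultimately show "\<exists>h. is_hat G B H f h"
    unfolding is_hat_def by (intro exI[of _ "restrict h (carrier ?Q)"]) auto
next
  fix h k assume hk: "is_hat G B H f h" "is_hat G B H f k"
  show "h = k"
  proof (rule extensionalityI[of _ "carrier (Q_grp G B)"])
    show "h x = k x" if "x \<in> carrier (Q_grp G B)" for x
      by (rule Q_grp_hom_unique[OF assms(3) _ _ _ that]) (use hk in \<open>simp_all add: is_hat_def\<close>)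
  qed (use hk in \<open>auto simp: is_hat_def\<close>)
qed

lemma is_hat_hat:
  assumes "group G" "subgroup B G" "group H" "quadratic_rel G B H f"
  shows "is_hat G B H f (hat G B H f)"
  unfolding hat_def using ex1_is_hat[OF assms] by (rule theI')

section \<open>Group extensions from cocycles\<close>

text \<open>
  The extension of \<open>G\<close> by the abelian group \<open>C\<close> belonging to a 2-cocycle \<open>D\<close>.  The pair of units
  is its unit only if \<open>D\<close> is normalised, as every bilinear cocycle is.
\<close>

definition cocycle_group ::
    "'c monoid \<Rightarrow> 'a monoid \<Rightarrow> ('a \<Rightarrow> 'a \<Rightarrow> 'c) \<Rightarrow> ('c \<times> 'a) monoid" where
  "cocycle_group C G D =
     \<lparr>carrier = carrier C \<times> carrier G,
      monoid.mult = (\<lambda>(s, a) (t, b). (s \<otimes>\<^bsub>C\<^esub> t \<otimes>\<^bsub>C\<^esub> D a b, a \<otimes>\<^bsub>G\<^esub> b)),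
      one = (\<one>\<^bsub>C\<^esub>, \<one>\<^bsub>G\<^esub>)\<rparr>"

lemma cocycle_group_simps [simp]:
  "carrier (cocycle_group C G D) = carrier C \<times> carrier G"
  "(s, a) \<otimes>\<^bsub>cocycle_group C G D\<^esub> (t, b) = (s \<otimes>\<^bsub>C\<^esub> t \<otimes>\<^bsub>C\<^esub> D a b, a \<otimes>\<^bsub>G\<^esub> b)"
  "\<one>\<^bsub>cocycle_group C G D\<^esub> = (\<one>\<^bsub>C\<^esub>, \<one>\<^bsub>G\<^esub>)"
  by (simp_all add: cocycle_group_def)

lemma group_cocycle_group:
  assumes "comm_group C" "group G" "two_cocycle G C D"
    and "\<And>a. a \<in> carrier G \<Longrightarrow> D \<one>\<^bsub>G\<^esub> a = \<one>\<^bsub>C\<^esub>"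
  shows "group (cocycle_group C G D)"
proof -
  interpret C: comm_group C by fact
  interpret G: group G by fact
  have D [simp]: "D a b \<in> carrier C" if "a \<in> carrier G" "b \<in> carrier G" for a b
    using assms(3) that by (simp add: two_cocycle_def)
  show ?thesis
  proof (rule groupI)
    fix x y z
    assume "x \<in> carrier (cocycle_group C G D)" "y \<in> carrier (cocycle_group C G D)"
      "z \<in> carrier (cocycle_group C G D)"
    then obtain s a t b u c where x: "x = (s, a)" "y = (t, b)" "z = (u, c)"
      and carr: "s \<in> carrier C" "t \<in> carrier C" "u \<in> carrier C"
        "a \<in> carrier G" "b \<in> carrier G" "c \<in> carrier G"
      by auto
    have "(s \<otimes>\<^bsub>C\<^esub> t \<otimes>\<^bsub>C\<^esub> D a b) \<otimes>\<^bsub>C\<^esub> u \<otimes>\<^bsub>C\<^esub> D (a \<otimes>\<^bsub>G\<^esub> b) c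
        = (s \<otimes>\<^bsub>C\<^esub> t \<otimes>\<^bsub>C\<^esub> u) \<otimes>\<^bsub>C\<^esub> (D a b \<otimes>\<^bsub>C\<^esub> D (a \<otimes>\<^bsub>G\<^esub> b) c)"
      using carr by (simp add: C.m_ac)
    also have "D a b \<otimes>\<^bsub>C\<^esub> D (a \<otimes>\<^bsub>G\<^esub> b) c = D b c \<otimes>\<^bsub>C\<^esub> D a (b \<otimes>\<^bsub>G\<^esub> c)"
      using assms(3) carr by (simp add: two_cocycle_def)
    also have "(s \<otimes>\<^bsub>C\<^esub> t \<otimes>\<^bsub>C\<^esub> u) \<otimes>\<^bsub>C\<^esub> (D b c \<otimes>\<^bsub>C\<^esub> D a (b \<otimes>\<^bsub>G\<^esub> c))
        = s \<otimes>\<^bsub>C\<^esub> (t \<otimes>\<^bsub>C\<^esub> u \<otimes>\<^bsub>C\<^esub> D b c) \<otimes>\<^bsub>C\<^esub> D a (b \<otimes>\<^bsub>G\<^esub> c)"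
      using carr by (simp add: C.m_ac)
    finally show "x \<otimes>\<^bsub>cocycle_group C G D\<^esub> y \<otimes>\<^bsub>cocycle_group C G D\<^esub> z
        = x \<otimes>\<^bsub>cocycle_group C G D\<^esub> (y \<otimes>\<^bsub>cocycle_group C G D\<^esub> z)"
      using carr by (simp add: x G.m_assoc)
  next
    fix x assume "x \<in> carrier (cocycle_group C G D)"
    then obtain s a where x: "x = (s, a)" "s \<in> carrier C" "a \<in> carrier G" by auto
    define y where "y = (inv\<^bsub>C\<^esub> (s \<otimes>\<^bsub>C\<^esub> D (inv\<^bsub>G\<^esub> a) a), inv\<^bsub>G\<^esub> a)"
    have "y \<otimes>\<^bsub>cocycle_group C G D\<^esub> x = \<one>\<^bsub>cocycle_group C G D\<^esub>"
      using x by (simp add: y_def C.m_assoc)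
    moreover have "y \<in> carrier (cocycle_group C G D)" using x by (simp add: y_def)
    ultimately show "\<exists>y\<in>carrier (cocycle_group C G D).
        y \<otimes>\<^bsub>cocycle_group C G D\<^esub> x = \<one>\<^bsub>cocycle_group C G D\<^esub>" by blast
  qed (auto simp: assms(4))
qed

lemma bilinear_mapI:
  assumes "\<And>a b. a \<in> carrier G \<Longrightarrow> b \<in> carrier G \<Longrightarrow> D a b \<in> carrier C"
    and "\<And>a b c. a \<in> carrier G \<Longrightarrow> b \<in> carrier G \<Longrightarrow> c \<in> carrier G \<Longrightarrow>
      D (a \<otimes>\<^bsub>G\<^esub> b) c = D a c \<otimes>\<^bsub>C\<^esub> D b c"
    and "\<And>a b c. a \<in> carrier G \<Longrightarrow> b \<in> carrier G \<Longrightarrow> c \<in> carrier G \<Longrightarrow>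
      D c (a \<otimes>\<^bsub>G\<^esub> b) = D c a \<otimes>\<^bsub>C\<^esub> D c b"
  shows "bilinear_map G C D"
  using assms by (simp add: bilinear_map_def hom_def)

lemma bilinear_mapD:
  assumes "bilinear_map G C D"
  shows "\<And>a b. a \<in> carrier G \<Longrightarrow> b \<in> carrier G \<Longrightarrow> D a b \<in> carrier C"
    and "\<And>a b c. a \<in> carrier G \<Longrightarrow> b \<in> carrier G \<Longrightarrow> c \<in> carrier G \<Longrightarrow>
      D (a \<otimes>\<^bsub>G\<^esub> b) c = D a c \<otimes>\<^bsub>C\<^esub> D b c"
    and "\<And>a b c. a \<in> carrier G \<Longrightarrow> b \<in> carrier G \<Longrightarrow> c \<in> carrier G \<Longrightarrow>
      D c (a \<otimes>\<^bsub>G\<^esub> b) = D c a \<otimes>\<^bsub>C\<^esub> D c b"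
  using assms by (auto simp: bilinear_map_def hom_def)

lemma bilinear_map_one:
  assumes "group G" "group C" "bilinear_map G C D" "a \<in> carrier G"
  shows "D \<one>\<^bsub>G\<^esub> a = \<one>\<^bsub>C\<^esub>" and "D a \<one>\<^bsub>G\<^esub> = \<one>\<^bsub>C\<^esub>"
  using assms(3,4) hom_one[OF _ assms(1,2), of "\<lambda>b. D b a"] hom_one[OF _ assms(1,2), of "D a"]
  by (simp_all add: bilinear_map_def)

lemma two_cocycle_of_bilinear_map:
  assumes "comm_group C" "bilinear_map G C D" "group G"
  shows "two_cocycle G C D"
proof -
  interpret C: comm_group C by fact
  show ?thesis
    by (simp add: two_cocycle_def bilinear_mapD[OF assms(2)] C.m_ac)
qed

section \<open>The canonical extension\<close>

context
  fixes G :: "'a monoid" and B :: "'a set"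
  assumes G: "group G" and B: "subgroup B G"
begin

interpretation G: group G by (rule G)

lemmas normal_BG' = BG'_normal[OF G B]

lemma group_quotient: "group (G Mod BG' G B)"
  using normal_BG' by (rule normal.factorgroup_is_group)

lemma bar_hom: "bar G B \<in> hom G (G Mod BG' G B)"
  using normal.r_coset_hom_Mod[OF normal_BG'] by (simp add: bar_def[abs_def])

lemma bar_surj:
  assumes "U \<in> carrier (G Mod BG' G B)"
  obtains a where "a \<in> carrier G" "U = bar G B a"
  using assms by (auto simp: FactGroup_def RCOSETS_def bar_def)

lemma comm_group_T_grp: "comm_group (T_grp G B)"
  unfolding T_grp_def by (intro comm_group_tensor group_quotient)

interpretation T: comm_group "T_grp G B" by (rule comm_group_T_grp)

lemma bilinear_map_bar_tens: "bilinear_map G (T_grp G B) (bar_tens G B)"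
  by (rule bilinear_mapI)
    (simp_all add: bar_tens_def T_grp_def hom_in_carrier[OF bar_hom] hom_mult[OF bar_hom]
      tens_closed[OF group_quotient group_quotient]
      tens_mult_left[OF group_quotient group_quotient]
      tens_mult_right[OF group_quotient group_quotient] del: mult_FactGroup)

lemmas bar_tens_closed = bilinear_mapD(1)[OF bilinear_map_bar_tens]

lemma T_grp_hom_unique:
  assumes "group H" "h \<in> hom (T_grp G B) H" "k \<in> hom (T_grp G B) H"
    and eq: "\<And>a b. a \<in> carrier G \<Longrightarrow> b \<in> carrier G \<Longrightarrow> h (bar_tens G B a b) = k (bar_tens G B a b)"
    and "t \<in> carrier (T_grp G B)"
  shows "h t = k t"
proof (rule tensor_hom_unique[OF group_quotient group_quotient assms(1)])
  show "h (tens (G Mod BG' G B) (G Mod BG' G B) U V) = k (tens (G Mod BG' G B) (G Mod BG' G B) U V)"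
    if XY: "U \<in> carrier (G Mod BG' G B)" "V \<in> carrier (G Mod BG' G B)" for U V
  proof -
    obtain a b where "a \<in> carrier G" "U = bar G B a" "b \<in> carrier G" "V = bar G B b"
      using bar_surj[OF XY(1)] bar_surj[OF XY(2)] by metis
    then show ?thesis using eq[of a b] by (simp add: bar_tens_def)
  qed
qed (use assms in \<open>simp_all add: T_grp_def\<close>)

lemma bilinear_map_D_cocycle: "bilinear_map G (T_grp G B) (D_cocycle G B)"
  by (rule bilinear_mapI)
    (simp_all add: D_cocycle_def bar_tens_closed bilinear_mapD(2,3)[OF bilinear_map_bar_tens] T.inv_mult)

lemma bar_tens_subgroup:
  assumes "b \<in> B" "a \<in> carrier G"
  shows "bar_tens G B b a = \<one>\<^bsub>T_grp G B\<^esub>" and "bar_tens G B a b = \<one>\<^bsub>T_grp G B\<^esub>"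
proof -
  have "b \<in> carrier G" using B assms(1) by (rule subgroup.mem_carrier)
  then have "b = b \<otimes>\<^bsub>G\<^esub> \<one>\<^bsub>G\<^esub>" by simp
  moreover have "\<one>\<^bsub>G\<^esub> \<in> derived G (carrier G)"
    by (simp add: derived_def generate.one)
  ultimately have "b \<in> BG' G B"
    using assms(1) unfolding BG'_def set_mult_def by blast
  then have "bar G B b = bar G B \<one>\<^bsub>G\<^esub>"
    using \<open>b \<in> carrier G\<close> subgroup.one_closed[OF normal_imp_subgroup[OF normal_BG']]
      G.coset_join2[OF _ normal_imp_subgroup[OF normal_BG']]
    by (simp add: bar_def)
  then show "bar_tens G B b a = \<one>\<^bsub>T_grp G B\<^esub>" "bar_tens G B a b = \<one>\<^bsub>T_grp G B\<^esub>"
    using bilinear_map_one[OF G T.is_group bilinear_map_bar_tens assms(2)]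
    by (simp_all add: bar_tens_def)
qed

text \<open>
  The explicit model of \<open>Q(G,B)\<close>, in which \<open>(1,a)\<close> plays the role of \<open>q a\<close>.
\<close>

abbreviation (input) "E \<equiv> cocycle_group (T_grp G B) G (D_cocycle G B)"

lemma group_E: "group E"
  by (intro group_cocycle_group comm_group_T_grp G two_cocycle_of_bilinear_map
      bilinear_map_D_cocycle bilinear_map_one(1)[OF G T.is_group])

interpretation E: group E by (rule group_E)

lemmas D_cocycle_closed = bilinear_mapD(1)[OF bilinear_map_D_cocycle]

lemmas D_cocycle_one = bilinear_map_one[OF G T.is_group bilinear_map_D_cocycle]

lemma dev_E:
  assumes "a \<in> carrier G" "b \<in> carrier G"
  shows "dev G E (Pair \<one>\<^bsub>T_grp G B\<^esub>) a b = (bar_tens G B a b, \<one>\<^bsub>G\<^esub>)"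
  using assms
  by (subst dev_eq_iff[OF G group_E])
    (auto simp: bar_tens_closed D_cocycle_closed D_cocycle_one, auto simp: D_cocycle_def bar_tens_closed)

lemma quadratic_rel_E: "quadratic_rel G B E (Pair \<one>\<^bsub>T_grp G B\<^esub>)"
proof -
  have "bilinear_map G E (dev G E (Pair \<one>\<^bsub>T_grp G B\<^esub>))"
    by (rule bilinear_mapI)
      (simp_all add: dev_E bar_tens_closed D_cocycle_one
        bilinear_mapD(2,3)[OF bilinear_map_bar_tens])
  moreover have "b \<in> carrier G" if "b \<in> B" for b
    using B that by (rule subgroup.mem_carrier)
  ultimately show ?thesis
    unfolding quadratic_rel_def quadratic_def
    by (auto simp: dev_E bar_tens_closed D_cocycle_one bar_tens_subgroup)
qed

abbreviation (input) "Q \<equiv> Q_grp G B"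
abbreviation (input) "q \<equiv> q_map G B"
abbreviation (input) "w \<equiv> w_map G B (Q_grp G B) (q_map G B)"
abbreviation (input) "p \<equiv> hat G B G id"

interpretation Q: group Q by (rule group_Q_grp)

lemma q_closed: "a \<in> carrier G \<Longrightarrow> q a \<in> carrier Q"
  using q_map_closed[of G B] by auto

lemma dev_q_bilinear: "bilinear_map G Q (dev G Q q)"
  using quadratic_rel_q_map[OF G B] by (simp add: quadratic_rel_def quadratic_def)

lemma dev_q_central:
  assumes "a \<in> carrier G" "b \<in> carrier G"
  shows "dev G Q q a b \<in> centre Q"
  using quadratic_rel_q_map[OF G B] assms
  by (intro central_Q_grpI bilinear_mapD(1)[OF dev_q_bilinear])
    (auto simp: quadratic_rel_def quadratic_def)

text \<open>
  A homomorphism with the defining property of \<open>w\<close>, without the normalisation outside the carrier.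
  The bilinear map on \<open>G/BG'\<close> is the deviation of \<open>q\<close> evaluated at arbitrary representatives.
\<close>

lemma w_exists:
  obtains h where "h \<in> hom (T_grp G B) Q" "h ` carrier (T_grp G B) \<subseteq> centre Q"
    "\<And>a b. a \<in> carrier G \<Longrightarrow> b \<in> carrier G \<Longrightarrow> h (bar_tens G B a b) = dev G Q q a b"
proof -
  let ?M = "G Mod BG' G B"
  have "\<forall>U\<in>carrier ?M. \<exists>a. a \<in> carrier G \<and> bar G B a = U"
    by (blast elim: bar_surj)
  then obtain rep where rep: "\<forall>U\<in>carrier ?M. rep U \<in> carrier G \<and> bar G B (rep U) = U"
    by (rule bchoice[THEN exE])
  define \<phi> where "\<phi> = (\<lambda>U V. dev G Q q (rep U) (rep V))"
  have \<phi>: "\<phi> (bar G B a) (bar G B b) = dev G Q q a b" if "a \<in> carrier G" "b \<in> carrier G" for a b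
    unfolding \<phi>_def
    by (rule dev_bar_cong[OF G group_Q_grp B quadratic_rel_q_map[OF G B]])
      (use that rep hom_in_carrier[OF bar_hom] in auto)
  obtain h where h: "h \<in> hom (T_grp G B) Q" "h ` carrier (T_grp G B) \<subseteq> centre Q"
      "\<And>U V. U \<in> carrier ?M \<Longrightarrow> V \<in> carrier ?M \<Longrightarrow> h (tens ?M ?M U V) = \<phi> U V"
  proof (rule tensor_hom_exists[where \<phi> = \<phi>, OF group_quotient group_quotient group_Q_grp])
    show "\<phi> U V \<in> centre Q" if "U \<in> carrier ?M" "V \<in> carrier ?M" for U V
      unfolding \<phi>_def using that rep by (intro dev_q_central) auto
    show "\<phi> (U \<otimes>\<^bsub>?M\<^esub> U') V = \<phi> U V \<otimes>\<^bsub>Q\<^esub> \<phi> U' V"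
      if carr: "U \<in> carrier ?M" "U' \<in> carrier ?M" "V \<in> carrier ?M" for U U' V
    proof -
      obtain a where "a \<in> carrier G" "U = bar G B a" by (rule bar_surj[OF carr(1)])
      moreover obtain a' where "a' \<in> carrier G" "U' = bar G B a'" by (rule bar_surj[OF carr(2)])
      moreover obtain b where "b \<in> carrier G" "V = bar G B b" by (rule bar_surj[OF carr(3)])
      ultimately show ?thesis
        by (simp add: \<phi> bilinear_mapD(2)[OF dev_q_bilinear] del: mult_FactGroup flip: hom_mult[OF bar_hom])
    qed
    show "\<phi> U (V \<otimes>\<^bsub>?M\<^esub> V') = \<phi> U V \<otimes>\<^bsub>Q\<^esub> \<phi> U V'"
      if carr: "U \<in> carrier ?M" "V \<in> carrier ?M" "V' \<in> carrier ?M" for U V V'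
    proof -
      obtain a where "a \<in> carrier G" "U = bar G B a" by (rule bar_surj[OF carr(1)])
      moreover obtain b where "b \<in> carrier G" "V = bar G B b" by (rule bar_surj[OF carr(2)])
      moreover obtain b' where "b' \<in> carrier G" "V' = bar G B b'" by (rule bar_surj[OF carr(3)])
      ultimately show ?thesis
        by (simp add: \<phi> bilinear_mapD(3)[OF dev_q_bilinear] del: mult_FactGroup flip: hom_mult[OF bar_hom])
    qed
  qed (simp add: T_grp_def)
  have "h (bar_tens G B a b) = dev G Q q a b" if "a \<in> carrier G" "b \<in> carrier G" for a b
    using that by (simp add: bar_tens_def h(3) \<phi> hom_in_carrier[OF bar_hom])
  with h(1,2) show thesis by (rule that)
qed

lemma is_w_unique:
  assumes "group H" "is_w G B H f h" "is_w G B H f k"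
  shows "h = k"
proof (rule extensionalityI[of _ "carrier (T_grp G B)"])
  show "h t = k t" if "t \<in> carrier (T_grp G B)" for t
    by (rule T_grp_hom_unique[OF assms(1) _ _ _ that]) (use assms(2,3) in \<open>simp_all add: is_w_def\<close>)
qed (use assms(2,3) in \<open>simp_all add: is_w_def\<close>)

lemma is_w_w_map: "is_w G B Q q w" and w_central: "t \<in> carrier (T_grp G B) \<Longrightarrow> w t \<in> centre Q"
proof -
  obtain h where h: "h \<in> hom (T_grp G B) Q" "h ` carrier (T_grp G B) \<subseteq> centre Q"
    "\<And>a b. a \<in> carrier G \<Longrightarrow> b \<in> carrier G \<Longrightarrow> h (bar_tens G B a b) = dev G Q q a b"
    using w_exists by blast
  let ?h = "restrict h (carrier (T_grp G B))"
  have "?h \<in> hom (T_grp G B) Q"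
    using h(1) by (rule T.hom_restrict) simp
  then have is_w: "is_w G B Q q ?h"
    using h(3) by (simp add: is_w_def bar_tens_closed)
  then have w: "w = ?h"
    unfolding w_map_def using is_w_unique[OF group_Q_grp] by (intro the_equality) blast+
  show "is_w G B Q q w" unfolding w by (rule is_w)
  show "w t \<in> centre Q" if "t \<in> carrier (T_grp G B)"
    unfolding w using that h(2) by auto
qed

lemma w_hom: "w \<in> hom (T_grp G B) Q"
  and w_bar_tens: "\<And>a b. a \<in> carrier G \<Longrightarrow> b \<in> carrier G \<Longrightarrow> w (bar_tens G B a b) = dev G Q q a b"
  using is_w_w_map by (simp_all add: is_w_def)

interpretation w: group_hom "T_grp G B" Q w
  using w_hom by unfold_locales

lemma is_hat_id: "is_hat G B G id p"
  using G B by (intro is_hat_hat quadratic_rel_of_hom) (auto simp: hom_def)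

lemma p_hom: "p \<in> hom Q G" and p_q: "\<And>a. a \<in> carrier G \<Longrightarrow> p (q a) = a"
  using is_hat_id by (simp_all add: is_hat_def)

interpretation p: group_hom Q G p
  using p_hom by unfold_locales

lemma p_w:
  assumes "t \<in> carrier (T_grp G B)"
  shows "p (w t) = \<one>\<^bsub>G\<^esub>"
proof -
  have "(p \<circ> w) t = (\<lambda>_. \<one>\<^bsub>G\<^esub>) t"
  proof (rule T_grp_hom_unique[OF G Group.hom_compose[OF w_hom p_hom] _ _ assms])
    fix a b assume ab: "a \<in> carrier G" "b \<in> carrier G"
    have "p (dev G Q q a b) = \<one>\<^bsub>G\<^esub>"
      using ab by (simp add: dev_def q_closed p_q G.m_assoc G.inv_mult_group[symmetric])
    then show "(p \<circ> w) (bar_tens G B a b) = \<one>\<^bsub>G\<^esub>" using ab by (simp add: w_bar_tens)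
  qed (simp add: hom_def)
  then show ?thesis by simp
qed

lemma q_mult:
  assumes "a \<in> carrier G" "b \<in> carrier G"
  shows "q a \<otimes>\<^bsub>Q\<^esub> q b = w (D_cocycle G B a b) \<otimes>\<^bsub>Q\<^esub> q (a \<otimes>\<^bsub>G\<^esub> b)"
proof -
  have "q (a \<otimes>\<^bsub>G\<^esub> b) = w (bar_tens G B a b) \<otimes>\<^bsub>Q\<^esub> (q a \<otimes>\<^bsub>Q\<^esub> q b)"
    using assms dev_eq_iff[OF G group_Q_grp q_map_closed assms w.hom_closed[OF bar_tens_closed[OF assms]]]
    by (simp add: w_bar_tens)
  then show ?thesis
    using assms by (simp add: D_cocycle_def bar_tens_closed q_closed Q.inv_solve_left)
qed

text \<open>
  The homomorphism \<open>\<theta>\<close> induced by the quadratic map \<open>a \<mapsto> (1,a)\<close> recovers \<open>t\<close> from \<open>w t\<close>.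
\<close>

lemma hat_E:
  obtains \<theta> where "\<theta> \<in> hom Q E"
  "\<And>a. a \<in> carrier G \<Longrightarrow> \<theta> (q a) = (\<one>\<^bsub>T_grp G B\<^esub>, a)"
  "\<And>t. t \<in> carrier (T_grp G B) \<Longrightarrow> \<theta> (w t) = (t, \<one>\<^bsub>G\<^esub>)"
proof -
  obtain \<theta> where \<theta>: "\<theta> \<in> hom Q E" "\<And>a. a \<in> carrier G \<Longrightarrow> \<theta> (q a) = (\<one>\<^bsub>T_grp G B\<^esub>, a)"
    using is_hat_hat[OF G B group_E quadratic_rel_E] unfolding is_hat_def by blast
  have "(\<theta> \<circ> w) t = (\<lambda>t. (t, \<one>\<^bsub>G\<^esub>)) t" if t: "t \<in> carrier (T_grp G B)" for t
  proof (rule T_grp_hom_unique[OF group_E Group.hom_compose[OF w_hom \<theta>(1)] _ _ t])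
    show "(\<lambda>t. (t, \<one>\<^bsub>G\<^esub>)) \<in> hom (T_grp G B) E"
      by (rule homI) (auto simp: D_cocycle_one)
    fix a b assume ab: "a \<in> carrier G" "b \<in> carrier G"
    have "\<theta> (dev G Q q a b) = dev G E (\<theta> \<circ> q) a b"
      using ab by (intro hom_dev[OF G group_Q_grp group_E \<theta>(1) q_map_closed])
    also have "\<dots> = dev G E (Pair \<one>\<^bsub>T_grp G B\<^esub>) a b"
      using ab by (simp add: dev_def \<theta>(2))
    finally show "(\<theta> \<circ> w) (bar_tens G B a b) = (bar_tens G B a b, \<one>\<^bsub>G\<^esub>)"
      using ab by (simp add: w_bar_tens dev_E)
  qed
  then show thesis using that[OF \<theta>] by simp
qed

lemma w_inj: "inj_on w (carrier (T_grp G B))"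
proof -
  obtain \<theta> where \<theta>: "\<And>t. t \<in> carrier (T_grp G B) \<Longrightarrow> \<theta> (w t) = (t, \<one>\<^bsub>G\<^esub>)"
    using hat_E by blast
  show ?thesis
  proof (rule inj_on_inverseI)
    show "fst (\<theta> (w t)) = t" if "t \<in> carrier (T_grp G B)" for t using \<theta>[OF that] by simp
  qed
qed

text \<open>
  The map \<open>\<gamma>: (t,a) \<mapsto> w t \<cdot> q a\<close> is a left inverse of \<open>\<theta>\<close>.
\<close>

lemma Q_decomposition:
  assumes "x \<in> carrier Q"
  obtains t a where "t \<in> carrier (T_grp G B)" "a \<in> carrier G" "x = w t \<otimes>\<^bsub>Q\<^esub> q a"
proof -
  obtain \<theta> where \<theta>: "\<theta> \<in> hom Q E" "\<And>a. a \<in> carrier G \<Longrightarrow> \<theta> (q a) = (\<one>\<^bsub>T_grp G B\<^esub>, a)"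
    using hat_E by metis
  define \<gamma> where "\<gamma> = (\<lambda>(t, a). w t \<otimes>\<^bsub>Q\<^esub> q a)"
  have \<gamma>: "\<gamma> \<in> hom E Q"
  proof (rule homI)
    show "\<gamma> x \<in> carrier Q" if "x \<in> carrier E" for x
      using that by (auto simp: \<gamma>_def q_closed)
    fix x y assume "x \<in> carrier E" "y \<in> carrier E"
    then obtain s a t b where x: "x = (s, a)" "y = (t, b)"
      and st: "s \<in> carrier (T_grp G B)" "t \<in> carrier (T_grp G B)"
      and ab: "a \<in> carrier G" "b \<in> carrier G" by auto
    note [simp] = q_closed[OF ab(1)] q_closed[OF ab(2)] q_closed[OF G.m_closed[OF ab]]
      w.hom_closed[OF st(1)] w.hom_closed[OF st(2)] w.hom_closed[OF D_cocycle_closed[OF ab]]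
    have "\<gamma> (x \<otimes>\<^bsub>E\<^esub> y) = w s \<otimes>\<^bsub>Q\<^esub> w t \<otimes>\<^bsub>Q\<^esub> (w (D_cocycle G B a b) \<otimes>\<^bsub>Q\<^esub> q (a \<otimes>\<^bsub>G\<^esub> b))"
      using st by (simp add: x \<gamma>_def D_cocycle_closed[OF ab] Q.m_assoc)
    also have "\<dots> = w s \<otimes>\<^bsub>Q\<^esub> (w t \<otimes>\<^bsub>Q\<^esub> q a) \<otimes>\<^bsub>Q\<^esub> q b"
      unfolding q_mult[OF ab, symmetric] by (simp add: Q.m_assoc)
    \<comment> \<open>The image of \<open>w\<close> is central.\<close>
    also have "w t \<otimes>\<^bsub>Q\<^esub> q a = q a \<otimes>\<^bsub>Q\<^esub> w t"
      using w_central[OF st(2)] by (rule centre_commute) simp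
    finally show "\<gamma> (x \<otimes>\<^bsub>E\<^esub> y) = \<gamma> x \<otimes>\<^bsub>Q\<^esub> \<gamma> y"
      by (simp add: x \<gamma>_def Q.m_assoc)
  qed
  \<comment> \<open>Both sides are endomorphisms of \<open>Q\<close>, so it suffices to compare them on the generators.\<close>
  have "(\<gamma> \<circ> \<theta>) x = id x"
  proof (rule Q_grp_hom_unique[OF group_Q_grp Group.hom_compose[OF \<theta>(1) \<gamma>] _ _ assms])
    show "(\<gamma> \<circ> \<theta>) (q a) = id (q a)" if "a \<in> carrier G" for a
      using that w.hom_one by (simp add: \<theta>(2) \<gamma>_def q_closed)
  qed (simp add: hom_def)
  moreover obtain t a where "\<theta> x = (t, a)" "t \<in> carrier (T_grp G B)" "a \<in> carrier G"
    using hom_in_carrier[OF \<theta>(1) assms] by auto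
  ultimately show thesis using that by (simp add: \<gamma>_def)
qed

lemma q_one: "q \<one>\<^bsub>G\<^esub> = \<one>\<^bsub>Q\<^esub>"
proof -
  have "dev G Q q \<one>\<^bsub>G\<^esub> \<one>\<^bsub>G\<^esub> = \<one>\<^bsub>Q\<^esub>"
    by (rule bilinear_map_one(1)[OF G group_Q_grp dev_q_bilinear]) simp
  then show ?thesis by (simp add: dev_def q_closed)
qed

lemma w_image: "w ` carrier (T_grp G B) = kernel Q G p"
proof
  show "w ` carrier (T_grp G B) \<subseteq> kernel Q G p"
    by (auto simp: kernel_def p_w)
  show "kernel Q G p \<subseteq> w ` carrier (T_grp G B)"
  proof
    fix x assume "x \<in> kernel Q G p"
    then have x: "x \<in> carrier Q" "p x = \<one>\<^bsub>G\<^esub>" by (auto simp: kernel_def)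
    obtain t a where ta: "t \<in> carrier (T_grp G B)" "a \<in> carrier G" "x = w t \<otimes>\<^bsub>Q\<^esub> q a"
      using Q_decomposition[OF x(1)] .
    then have "a = \<one>\<^bsub>G\<^esub>" using x(2) by (simp add: p_w p_q q_closed)
    then show "x \<in> w ` carrier (T_grp G B)" using ta q_one by simp
  qed
qed

lemma central_extension_Q_grp: "central_extension (T_grp G B) Q G w p"
  unfolding central_extension_def group_extension_def
proof (intro conjI ballI)
  show "w \<in> mon (T_grp G B) Q" using w_hom w_inj by (simp add: mon_def)
  have "a \<in> p ` carrier Q" if "a \<in> carrier G" for a
    using p_q[OF that] q_closed[OF that] by (metis imageI)
  then show "p \<in> epi Q G" using p_hom by (auto simp: epi_def)
  show "w c \<otimes>\<^bsub>Q\<^esub> x = x \<otimes>\<^bsub>Q\<^esub> w c" if "c \<in> carrier (T_grp G B)" "x \<in> carrier Q" for c x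
    using w_central[OF that(1)] that(2) by (rule centre_commute)
qed (simp_all add: w_image G group_Q_grp T.is_group)

lemma represented_by_D_cocycle: "represented_by (T_grp G B) Q G w p q (D_cocycle G B)"
  unfolding represented_by_def section_of_def
  using two_cocycle_of_bilinear_map[OF comm_group_T_grp bilinear_map_D_cocycle G]
  by (simp add: q_map_closed p_q q_mult)

end

theorem theorem1p15:
  fixes G :: "'a monoid" and B :: "'a set"
  assumes "group G" and "subgroup B G"
  shows
    "(group (Q_grp G B) \<and> quadratic_rel G B (Q_grp G B) (q_map G B) \<and>
      (\<forall>(H :: 'h monoid) f. group H \<longrightarrow> quadratic_rel G B H f \<longrightarrow> (\<exists>!h. is_hat G B H f h)))
     \<and>
     (is_w G B (Q_grp G B) (q_map G B) (w_map G B (Q_grp G B) (q_map G B)) \<and>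
      is_hat G B G id (hat G B G id) \<and>
      central_extension (T_grp G B) (Q_grp G B) G
        (w_map G B (Q_grp G B) (q_map G B)) (hat G B G id) \<and>
      bilinear_map G (T_grp G B) (D_cocycle G B) \<and>
      represented_by (T_grp G B) (Q_grp G B) G
        (w_map G B (Q_grp G B) (q_map G B)) (hat G B G id) (q_map G B) (D_cocycle G B))"
  by (intro conjI allI impI group_Q_grp quadratic_rel_q_map ex1_is_hat is_w_w_map is_hat_id
      central_extension_Q_grp bilinear_map_D_cocycle represented_by_D_cocycle assms)

end
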